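(* Let $n\ge1$, $I=\{0,\dots,n\}$, let $\Gamma<\mathrm{SL}(2,\mathbb{C})$ be the cyclic subgroup of order $n+1$, let $I^+\subset I$ be a nonempty proper subset and $v\in\mathbb{N}^I$. The morphism $$\operatorname{Hilb}^v([\mathbb{C}^2/\Gamma])\to\operatorname{Quot}_{I^+}^{v|_{I^+}}([\mathbb{C}^2/\Gamma])$$ is $T$-equivariant, and hence maps $T$-fixed points to $T$-fixed points. Under the bijections between $T$-fixed points of $\operatorname{Hilb}^v([\mathbb{C}^2/\Gamma])$ and $\{\lambda\in\mathcal{P}:\underline{\mathrm{wt}}(\lambda)=v\}$, and between $T$-fixed points of $\operatorname{Quot}_{I^+}^{v|_{I^+}}([\mathbb{C}^2/\Gamma])$ and $\{\lambda\in\mathcal{P}_{I^+}:\underline{\mathrm{wt}}_{I^+}(\lambda)=v|_{I^+}\}$, this mapping of fixed points is given by $\pi_{I^+}$.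
   Context: $\mathbb{N}$ contains $0$. Partitions. Label the block $(i,j)\in\mathbb{N}\times\mathbb{N}$ by $(i-j)\bmod(n+1)\in I$. $\mathcal{P}$ is the set of partitions, identified with Young diagrams in $\mathbb{N}\times\mathbb{N}$. $\mathrm{wt}_j(\lambda)$ is the number of blocks of $\lambda$ labelled $j$; $\underline{\mathrm{wt}}(\lambda)=(\mathrm{wt}_i(\lambda))_{i\in I}$, $\underline{\mathrm{wt}}_{I^+}(\lambda)=(\mathrm{wt}_i(\lambda))_{i\in I^+}$. $\lambda$ is $I^+$-generated if all its addable blocks have label in $I^+$; $\mathcal{P}_{I^+}$ is the set of these. $\pi_{I^+}:\mathcal{P}\to\mathcal{P}_{I^+}$ sends $\lambda$ to the smallest $I^+$-generated Young diagram containing $\lambda$. Moduli spaces. $R=\mathbb{C}[x,y]$; $\Gamma$ acts diagonally so that $x^ay^b$ lies in the isotypic component of the character $\rho_{(a-b)\bmod(n+1)}$, and $R_i\subset R$ denotes the $\rho_i$-isotypic component. $\operatorname{Hilb}^v([\mathbb{C}^2/\Gamma])$ parametrises $\Gamma$-invariant ideals $J\subset R$ with $R/J\cong\bigoplus_i\rho_i^{\oplus v_i}$. Let $R_{I^+}=\bigoplus_{i\in I^+}R_i$, a left module over $B_{I^+}=\operatorname{End}_{R^\Gamma}(R_{I^+})$; $\operatorname{Quot}_{I^+}^{v^+}([\mathbb{C}^2/\Gamma])$ is the fine moduli scheme of $B_{I^+}$-module quotients $R_{I^+}\to Z$ with $\dim e_iZ=v_i^+$ for $i\in I^+$, $e_i$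 being the projection onto $R_i$. The morphism sends an ideal $J=\bigoplus_{i\in I}J_i$ (isotypic decomposition) to the quotient of $R_{I^+}$ by $J^{I^+}=\bigoplus_{i\in I^+}J_i$. The torus $T=(\mathbb{C}^\times)^2$ acts on $\mathbb{C}^2$ diagonally, commuting with $\Gamma$, and hence on these moduli spaces. Bijections. $\lambda\in\mathcal{P}$ corresponds to the monomial ideal spanned by $x^ay^b$ with $(a,b)\notin\lambda$; $\lambda\in\mathcal{P}_{I^+}$ corresponds to the quotient of $R_{I^+}$ by the span of the monomials $x^ay^b$ with $(a,b)\notin\lambda$ and $(a-b)\bmod(n+1)\in I^+$. *)

theory Defs
  imports Complex_Main "HOL-Library.Poly_Mapping" "HOL-Library.Product_Plus"
begin

section \<open>Partitions\<close>

definition label :: "nat \<Rightarrow> nat \<times> nat \<Rightarrow> nat" where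
  "label n = (\<lambda>(i, j). nat ((int i - int j) mod (int n + 1)))"

definition partitions :: "(nat \<times> nat) set set" where
  "partitions = {\<nu>. finite \<nu> \<and> (\<forall>(a, b)\<in>\<nu>. \<forall>a'\<le>a. \<forall>b'\<le>b. (a', b') \<in> \<nu>)}"

definition wt :: "nat \<Rightarrow> nat \<Rightarrow> (nat \<times> nat) set \<Rightarrow> nat" where
  "wt n j \<nu> = card {c \<in> \<nu>. label n c = j}"

definition addable :: "(nat \<times> nat) set \<Rightarrow> (nat \<times> nat) set" where
  "addable \<nu> = {c. c \<notin> \<nu> \<and> insert c \<nu> \<in> partitions}"

definition generated_partitions :: "nat \<Rightarrow> nat set \<Rightarrow> (nat \<times> nat) set set" where
  "generated_partitions n Ip = {\<nu> \<in> partitions. \<forall>c\<in>addable \<nu>. label n c \<in> Ip}"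

definition pi_gen :: "nat \<Rightarrow> nat set \<Rightarrow> (nat \<times> nat) set \<Rightarrow> (nat \<times> nat) set" where
  "pi_gen n Ip \<nu> = (LEAST \<mu>. \<mu> \<in> generated_partitions n Ip \<and> \<nu> \<subseteq> \<mu>)"

section \<open>The coordinate ring of the plane, with its torus and group actions\<close>

text \<open>
  The moduli spaces are represented by their functors of points on commutative
  \<open>\<complex>\<close>-algebras \<open>A\<close>. Such an algebra is a type \<open>'a\<close> of class \<^class>\<open>comm_ring_1\<close> (the zero ring, whose
  spectrum is empty, is not of this class) together with a structure map \<open>alg :: complex \<Rightarrow> 'a\<close>;
  closed points are the case \<open>A = \<complex>\<close>, \<open>alg = id\<close>. The ring \<open>R \<otimes> A = A[x,y]\<close> is the monoid algebra
  of \<open>\<nat> \<times> \<nat>\<close>, the exponent \<open>(a, b)\<close> standing for \<open>x\<^sup>a y\<^sup>b\<close>.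
\<close>

type_synonym 'a plane = "(nat \<times> nat) \<Rightarrow>\<^sub>0 'a"

definition is_ring_hom :: "('a::comm_ring_1 \<Rightarrow> 'b::comm_ring_1) \<Rightarrow> bool" where
  "is_ring_hom h \<longleftrightarrow> h 1 = 1 \<and> (\<forall>x y. h (x + y) = h x + h y) \<and> (\<forall>x y. h (x * y) = h x * h y)"

definition mon :: "nat \<times> nat \<Rightarrow> 'a::comm_ring_1 plane" where
  "mon m = Poly_Mapping.single m 1"

definition scl :: "'a::comm_ring_1 \<Rightarrow> 'a plane \<Rightarrow> 'a plane" where
  "scl c p = Poly_Mapping.single 0 c * p"

text \<open>
  These two facts justify the uses of \<^const>\<open>module.subspace\<close> and \<^const>\<open>module.span\<close> below:
  for \<^term>\<open>scl\<close> they are \<open>A\<close>-submodules and \<open>A\<close>-linear spans, for multiplication they are ideals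
  and generated ideals.
\<close>

lemma module_scl: "module (scl :: 'a::comm_ring_1 \<Rightarrow> _)"
  by unfold_locales
    (simp_all add: scl_def distrib_left distrib_right single_add mult_single mult.assoc[symmetric])

lemma module_times: "module ((*) :: 'a::comm_ring_1 \<Rightarrow> _)"
  by unfold_locales (simp_all add: algebra_simps)

text \<open>
  \<open>T(A) = A\<^sup>\<times> \<times> A\<^sup>\<times>\<close>. We let \<open>(s, t)\<close> scale \<open>x\<^sup>a y\<^sup>b\<close> by \<open>s\<^sup>a t\<^sup>b\<close>; pulling functions back along the
  inverse instead precomposes the action with the inversion of the commutative group \<open>T\<close>, which
  affects neither equivariance nor fixed points.
\<close>

definition torus :: "('a::comm_ring_1 \<times> 'a) set" where
  "torus = {u. u dvd 1} \<times> {u. u dvd 1}"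

definition torus_act :: "'a::comm_ring_1 \<times> 'a \<Rightarrow> 'a plane \<Rightarrow> 'a plane" where
  "torus_act = (\<lambda>(s, t). Poly_Mapping.mapp (\<lambda>(a, b) c. s ^ a * t ^ b * c))"

text \<open>
  The cyclic subgroup of order \<open>n + 1\<close> of the special linear group, consisting of the diagonal
  matrices with entries \<open>(\<zeta>, \<zeta>\<^sup>-\<^sup>1)\<close>; the character \<open>\<rho>\<^sub>i\<close> maps such a matrix to \<open>\<zeta>\<^sup>i\<close>.
\<close>

definition Gam :: "nat \<Rightarrow> (complex \<times> complex) set" where
  "Gam n = {(\<zeta>, inverse \<zeta>) | \<zeta>. \<zeta> ^ (n + 1) = 1}"

definition rho :: "nat \<Rightarrow> complex \<times> complex \<Rightarrow> complex" where
  "rho i \<gamma> = fst \<gamma> ^ i"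

definition gam_act :: "(complex \<Rightarrow> 'a::comm_ring_1) \<Rightarrow> complex \<times> complex \<Rightarrow> 'a plane \<Rightarrow> 'a plane" where
  "gam_act alg \<gamma> = torus_act (map_prod alg alg \<gamma>)"

definition isotypic :: "nat \<Rightarrow> (complex \<Rightarrow> 'a::comm_ring_1) \<Rightarrow> nat \<Rightarrow> 'a plane set" where
  "isotypic n alg i = {p. \<forall>\<gamma>\<in>Gam n. gam_act alg \<gamma> p = scl (alg (rho i \<gamma>)) p}"

definition invariant_ring :: "nat \<Rightarrow> complex plane set" where
  "invariant_ring n = {r. \<forall>\<gamma>\<in>Gam n. gam_act id \<gamma> r = r}"

definition sum_of :: "nat set \<Rightarrow> (nat \<Rightarrow> 'a::comm_ring_1 plane set) \<Rightarrow> 'a plane set" where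
  "sum_of S N = {\<Sum>i\<in>S. p i | p. \<forall>i\<in>S. p i \<in> N i}"

text \<open>\<open>R\<^bsub>I+\<^esub> \<otimes> A\<close>\<close>

definition R_plus :: "nat \<Rightarrow> nat set \<Rightarrow> (complex \<Rightarrow> 'a::comm_ring_1) \<Rightarrow> 'a plane set" where
  "R_plus n Ip alg = sum_of Ip (isotypic n alg)"

text \<open>
  \<open>B\<^bsub>I+\<^esub>\<close>; the values of its elements outside \<open>R\<^bsub>I+\<^esub>\<close> are irrelevant.
\<close>

definition B_plus :: "nat \<Rightarrow> nat set \<Rightarrow> (complex plane \<Rightarrow> complex plane) set" where
  "B_plus n Ip = {\<phi>.
     (\<forall>p\<in>R_plus n Ip id. \<phi> p \<in> R_plus n Ip id) \<and>
     (\<forall>p\<in>R_plus n Ip id. \<forall>q\<in>R_plus n Ip id. \<phi> (p + q) = \<phi> p + \<phi> q) \<and>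
     (\<forall>r\<in>invariant_ring n. \<forall>p\<in>R_plus n Ip id. \<phi> (r * p) = r * \<phi> p)}"

text \<open>The \<open>A\<close>-linear extension of an endomorphism of \<open>R\<^bsub>I+\<^esub>\<close> to \<open>R\<^bsub>I+\<^esub> \<otimes> A\<close>.\<close>

definition extend :: "(complex \<Rightarrow> 'a::comm_ring_1) \<Rightarrow> (complex plane \<Rightarrow> complex plane) \<Rightarrow> 'a plane \<Rightarrow> 'a plane" where
  "extend alg \<phi> p =
     (\<Sum>m\<in>Poly_Mapping.keys p. scl (Poly_Mapping.lookup p m) (Poly_Mapping.map alg (\<phi> (mon m))))"

section \<open>Functors of points of the moduli spaces\<close>

text \<open>
  For \<open>A\<close>-submodules \<open>M\<close>, \<open>J\<close> of \<open>A[x,y]\<close> let \<open>Q\<close> be the image of \<open>M\<close> in \<open>A[x,y] / J\<close>. Then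
  \<open>is_zero_at f J p\<close> says that the class of \<open>p\<close> vanishes in the localisation of \<open>A[x,y] / J\<close> at \<open>f\<close>,
  and \<open>local_basis f M J K b\<close> says that the classes of \<open>b k \<in> M\<close>, for \<open>k \<in> K\<close>, form a basis of the
  localised module \<open>Q\<^sub>f\<close> over \<open>A\<^sub>f\<close>, with denominators cleared. Hence \<open>Q\<close> is locally free of
  rank \<open>r\<close> iff such bases with \<open>r\<close> elements exist for finitely many \<open>f\<close> generating the unit ideal.
  Over \<open>A = \<complex>\<close> this means that \<open>Q\<close> has dimension \<open>r\<close>.
\<close>

definition is_zero_at :: "'a::comm_ring_1 \<Rightarrow> 'a plane set \<Rightarrow> 'a plane \<Rightarrow> bool" where
  "is_zero_at f J p \<longleftrightarrow> (\<exists>N. scl (f ^ N) p \<in> J)"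

definition local_basis ::
    "'a::comm_ring_1 \<Rightarrow> 'a plane set \<Rightarrow> 'a plane set \<Rightarrow> 'k set \<Rightarrow> ('k \<Rightarrow> 'a plane) \<Rightarrow> bool" where
  "local_basis f M J K b \<longleftrightarrow>
     (\<forall>k\<in>K. b k \<in> M) \<and>
     (\<forall>p\<in>M. \<exists>N c. scl (f ^ N) p - (\<Sum>k\<in>K. scl (c k) (b k)) \<in> J) \<and>
     (\<forall>c. (\<Sum>k\<in>K. scl (c k) (b k)) \<in> J \<longrightarrow> (\<forall>k\<in>K. \<exists>N. f ^ N * c k = 0))"

definition is_cover :: "'a::comm_ring_1 set \<Rightarrow> bool" where
  "is_cover F \<longleftrightarrow> finite F \<and> module.span (*) F = UNIV"

text \<open>
  The \<open>A\<close>-points of the Hilbert scheme: \<open>\<Gamma>\<close>-invariant ideals \<open>J\<close> of \<open>A[x,y]\<close> whose quotient is,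
  locally on the spectrum of \<open>A\<close>, isomorphic to \<open>\<Oplus>\<^sub>i (\<rho>\<^sub>i \<otimes> A)\<^bsup>v i\<^esup>\<close> as a representation of \<open>\<Gamma>\<close>. An
  isomorphism is given by the images \<open>b (i, k)\<close>, \<open>k < v i\<close>, of the standard basis.
\<close>

definition Hilb :: "nat \<Rightarrow> (nat \<Rightarrow> nat) \<Rightarrow> (complex \<Rightarrow> 'a::comm_ring_1) \<Rightarrow> 'a plane set set" where
  "Hilb n v alg = {J.
     module.subspace (*) J \<and>
     (\<forall>\<gamma>\<in>Gam n. gam_act alg \<gamma> ` J \<subseteq> J) \<and>
     (\<exists>F. is_cover F \<and>
       (\<forall>f\<in>F. \<exists>b. local_basis f UNIV J (SIGMA i:{0..n}. {..<v i}) b \<and>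
         (\<forall>i\<le>n. \<forall>k<v i. \<forall>\<gamma>\<in>Gam n.
            is_zero_at f J (gam_act alg \<gamma> (b (i, k)) - scl (alg (rho i \<gamma>)) (b (i, k))))))}"

text \<open>
  The \<open>A\<close>-points of the Quot scheme: a quotient \<open>R\<^bsub>I+\<^esub> \<otimes> A \<rightarrow> Z\<close> is represented by its kernel \<open>K\<close>,
  and \<open>e\<^sub>i Z\<close> is the image of \<open>R\<^sub>i \<otimes> A\<close> in \<open>Z\<close>. Only the values \<open>v i\<close> for \<open>i \<in> I\<^sup>+\<close> enter, so the
  restriction of a dimension vector \<open>v\<close> on \<open>I\<close> to \<open>I\<^sup>+\<close> is left implicit.
\<close>

definition Quot :: "nat \<Rightarrow> nat set \<Rightarrow> (nat \<Rightarrow> nat) \<Rightarrow> (complex \<Rightarrow> 'a::comm_ring_1) \<Rightarrow> 'a plane set set" where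
  "Quot n Ip v alg = {K.
     K \<subseteq> R_plus n Ip alg \<and> module.subspace scl K \<and>
     (\<forall>\<phi>\<in>B_plus n Ip. extend alg \<phi> ` K \<subseteq> K) \<and>
     (\<forall>i\<in>Ip. \<exists>F. is_cover F \<and>
       (\<forall>f\<in>F. \<exists>b. local_basis f (isotypic n alg i) K {..<v i} b))}"

definition hilb_to_quot :: "nat \<Rightarrow> nat set \<Rightarrow> (complex \<Rightarrow> 'a::comm_ring_1) \<Rightarrow> 'a plane set \<Rightarrow> 'a plane set" where
  "hilb_to_quot n Ip alg J = sum_of Ip (\<lambda>i. J \<inter> isotypic n alg i)"

text \<open>
  Pull-back of families along \<open>h : A \<rightarrow> A'\<close>: the kernel of the base-changed quotient is the
  \<open>A'\<close>-linear span of the image of the kernel.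
\<close>

definition base_change :: "('a::comm_ring_1 \<Rightarrow> 'b::comm_ring_1) \<Rightarrow> 'a plane set \<Rightarrow> 'b plane set" where
  "base_change h K = module.span scl (Poly_Mapping.map h ` K)"

definition fixed_points :: "complex plane set set \<Rightarrow> complex plane set set" where
  "fixed_points X = {K \<in> X. \<forall>t\<in>torus. torus_act t ` K = K}"

definition monomial_ideal :: "(nat \<times> nat) set \<Rightarrow> complex plane set" where
  "monomial_ideal \<nu> = module.span scl (mon ` {m. m \<notin> \<nu>})"

definition monomial_kernel :: "nat \<Rightarrow> nat set \<Rightarrow> (nat \<times> nat) set \<Rightarrow> complex plane set" where
  "monomial_kernel n Ip \<nu> = module.span scl (mon ` {m. m \<notin> \<nu> \<and> label n m \<in> Ip})"

end

theory Submission
  imports Defs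
begin

text \<open>
  Everything is computed on coefficients. Over any \<open>\<complex>\<close>-algebra \<open>A\<close>, the torus, the group \<open>\<Gamma>\<close>, scalars
  and projections to spans of monomials act on \<open>A[x,y]\<close> by multiplying the coefficient of each
  monomial by a weight (\<open>weight_act\<close>). A submodule stable under such an operator contains the weight
  components of its elements as soon as distinct weights differ by units
  (\<open>weight_component_mem\<close>). For a generator of \<open>\<Gamma>\<close> the weights are roots of unity indexed by the labels,
  and their differences are nonzero complex numbers. So a \<open>\<Gamma>\<close>-invariant ideal \<open>J\<close> is the sum of its
  isotypic parts, and the morphism sends \<open>J\<close> to its intersection with the span of the monomials with
  labels in \<open>I\<^sup>+\<close> (\<open>hilb_to_quot_eq\<close>). In this form it visibly commutes with base change and with the torus.

  The intersection is a point of the Quot scheme for two reasons. First, every element of \<open>B\<^bsub>I+\<^esub>\<close> acts on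
  \<open>R\<^sub>i\<close> as multiplication by a polynomial (\<open>B_plus_is_multiplication\<close>). Being a \<open>B\<^bsub>I+\<^esub>\<close>-submodule therefore
  means being closed under multiplying isotypic components by monomials, as long as the labels stay in
  \<open>I\<^sup>+\<close> (\<open>B_plus_stable_iff_stable_under_moves\<close>); ideals have this property, and the torus preserves it.
  Second, a local basis of \<open>A[x,y] / J\<close> by eigenvectors projects to local bases of the isotypic parts
  (\<open>local_basis_isotypic\<close>).

  Over \<open>\<complex>\<close> the torus separates all monomials, so that fixed points are spanned by monomials
  (\<open>torus_fixed_eq_supported\<close>), and the rank conditions count the remaining monomials label by label
  (\<open>monomial_basis_card\<close>).

  What is left is combinatorics. The addable cells of a partition are the minimal elements of its
  complement, so a partition is \<open>I\<^sup>+\<close>-generated iff its complement is the upward closure of the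
  exponents in it with labels in \<open>I\<^sup>+\<close> (\<open>generated_partitions_iff\<close>). For arbitrary \<open>\<nu>\<close>, the exponents outside
  \<open>\<nu>\<close> with labels in \<open>I\<^sup>+\<close> have an upward closure whose complement is \<open>\<pi>\<^bsub>I+\<^esub>(\<nu>)\<close> (\<open>pi_gen_eq\<close>). This closure
  contains no other exponents with labels in \<open>I\<^sup>+\<close>, so \<open>\<nu>\<close> and \<open>\<pi>\<^bsub>I+\<^esub>(\<nu>)\<close> have the same cells with such
  labels (\<open>mem_pi_gen_iff\<close>). Hence they have the same weights on \<open>I\<^sup>+\<close>, and the monomial ideal of \<open>\<nu>\<close> and the
  monomial kernel of \<open>\<pi>\<^bsub>I+\<^esub>(\<nu>)\<close> contain the same monomials with labels in \<open>I\<^sup>+\<close>.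
\<close>

section \<open>Monomials and coefficients\<close>

interpretation plane: module "scl :: 'a::comm_ring_1 \<Rightarrow> 'a plane \<Rightarrow> 'a plane"
  by (rule module_scl)

lemma lookup_single_times_add [simp]:
  "Poly_Mapping.lookup (Poly_Mapping.single d c * p) (d + m) = c * Poly_Mapping.lookup p m"
  for p :: "'a::comm_ring_1 plane"
proof -
  have "(d + m = d + q) = (q = m)" for q :: "nat \<times> nat"
    by auto
  then show ?thesis
    by (simp add: lookup_mult lookup_single when_mult)
qed

lemma lookup_single_times_eq_0:
  assumes "\<And>m. k \<noteq> d + m"
  shows "Poly_Mapping.lookup (Poly_Mapping.single d c * (p :: 'a::comm_ring_1 plane)) k = 0"
  using assms by (simp add: lookup_mult lookup_single when_mult)

lemma lookup_scl [simp]: "Poly_Mapping.lookup (scl c p) m = c * Poly_Mapping.lookup p m"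
  using lookup_single_times_add[of 0 c p m] by (simp add: scl_def)

lemma lookup_mon: "Poly_Mapping.lookup (mon m) k = (if m = k then 1 else 0)"
  by (simp add: mon_def lookup_single when_def)

lemma lookup_mon_times_add [simp]:
  "Poly_Mapping.lookup (mon d * p) (d + m) = Poly_Mapping.lookup p m"
  by (simp add: mon_def)

lemma lookup_mon_times_outside:
  "k \<notin> range ((+) d) \<Longrightarrow> Poly_Mapping.lookup (mon d * p) k = 0"
  unfolding mon_def by (rule lookup_single_times_eq_0) blast

lemma mon_times_mon: "mon a * mon b = mon (a + b)"
  by (simp add: mon_def mult_single)

lemma keys_mon [simp]: "Poly_Mapping.keys (mon m :: 'a::comm_ring_1 plane) = {m}"
  by (simp add: mon_def)

lemma inj_mon: "inj (mon :: _ \<Rightarrow> 'a::comm_ring_1 plane)"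
  by (rule injI) (metis keys_mon the_elem_eq)

lemma mon_times_cancel: "mon d * p = mon d * q \<longleftrightarrow> p = q"
  by (metis lookup_mon_times_add poly_mapping_eqI)

lemma scl_times_right: "p * scl c q = scl c (p * q)"
  by (simp add: scl_def algebra_simps)

lemma scl_times_left: "scl c p * q = scl c (p * q)"
  by (simp add: scl_def algebra_simps)

lemma plane_expansion:
  "p = (\<Sum>m\<in>Poly_Mapping.keys p. scl (Poly_Mapping.lookup p m) (mon m))"
  by (rule poly_mapping_eqI) (simp add: lookup_sum lookup_mon if_distrib[of "\<lambda>x. _ * x"] in_keys_iff cong: if_cong)

lemma plane_induct [case_names zero add]:
  assumes "P 0" "\<And>c m p. P p \<Longrightarrow> P (scl c (mon m) + p)"
  shows "P (p :: 'a::comm_ring_1 plane)"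
proof -
  have "P (\<Sum>m\<in>A. scl (Poly_Mapping.lookup p m) (mon m))" if "finite A" for A
    using that by induct (use assms in auto)
  then show ?thesis
    using plane_expansion[of p] by (metis finite_keys)
qed

lemma subspace_ideal_imp_subspace_scl:
  assumes "module.subspace (*) (J :: 'a::comm_ring_1 plane set)"
  shows "plane.subspace J"
  using assms unfolding module.subspace_def[OF module_times] plane.subspace_def scl_def by blast

section \<open>Diagonal operators and spans of monomials\<close>

text \<open>
  The diagonal operator with eigenvalue \<open>w m\<close> on the monomial with exponent \<open>m\<close>. Scalars, the torus, the
  finite group and the projections to spans of monomials all have this form; this is why they
  commute with each other.
\<close>

definition weight_act :: "(nat \<times> nat \<Rightarrow> 'a::comm_ring_1) \<Rightarrow> 'a plane \<Rightarrow> 'a plane" where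
  "weight_act w = Poly_Mapping.mapp (\<lambda>m c. w m * c)"

lemma lookup_weight_act [simp]:
  "Poly_Mapping.lookup (weight_act w p) m = w m * Poly_Mapping.lookup p m"
  by (simp add: weight_act_def mapp.rep_eq when_def in_keys_iff)

lemma torus_act_eq_weight_act: "torus_act (s, t) = weight_act (\<lambda>(a, b). s ^ a * t ^ b)"
  unfolding torus_act_def weight_act_def by (simp add: case_prod_unfold)

lemma weight_act_add: "weight_act w (p + q) = weight_act w p + weight_act w q"
  by (rule poly_mapping_eqI) (simp add: lookup_add algebra_simps)

lemma weight_act_0 [simp]: "weight_act w 0 = 0"
  by (rule poly_mapping_eqI) simp

lemma weight_act_diff: "weight_act w (p - q) = weight_act w p - weight_act w q"
  by (rule poly_mapping_eqI) (simp add: lookup_minus algebra_simps)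

lemma weight_act_scl: "weight_act w (scl c p) = scl c (weight_act w p)"
  by (rule poly_mapping_eqI) (simp add: algebra_simps)

lemma weight_act_sum: "weight_act w (\<Sum>i\<in>A. f i) = (\<Sum>i\<in>A. weight_act w (f i))"
  by (induct A rule: infinite_finite_induct) (simp_all add: weight_act_add)

lemma weight_act_commute: "weight_act w (weight_act w' p) = weight_act w' (weight_act w p)"
  by (rule poly_mapping_eqI) (simp add: algebra_simps)

lemma weight_act_mon: "weight_act w (mon m) = scl (w m) (mon m)"
  by (rule poly_mapping_eqI) (simp add: lookup_mon)

text \<open>
  A multiplicative weight is a character of the monoid of exponents, and such a character acts by
  ring endomorphisms of the monoid algebra.
\<close>

lemma weight_act_times:
  assumes "\<And>m m'. w (m + m') = w m * w m'"
  shows "weight_act w (p * q) = weight_act w p * weight_act w q"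
proof (induct p rule: plane_induct)
  case zero
  show ?case by simp
next
  case (add c m p)
  have "weight_act w (mon m * q) = scl (w m) (mon m * weight_act w q)"
  proof (rule poly_mapping_eqI)
    fix k
    show "Poly_Mapping.lookup (weight_act w (mon m * q)) k =
        Poly_Mapping.lookup (scl (w m) (mon m * weight_act w q)) k"
    proof (cases "k \<in> range ((+) m)")
      case True
      then obtain m' where "k = m + m'" by blast
      then show ?thesis using assms[of m m'] by (simp only: lookup_weight_act lookup_scl lookup_mon_times_add mult.assoc)
    next
      case False
      then show ?thesis by (simp add: lookup_mon_times_outside)
    qed
  qed
  then show ?case
    using add by (simp add: distrib_right weight_act_add weight_act_scl weight_act_mon scl_times_left)
qed

definition supported :: "(nat \<times> nat) set \<Rightarrow> 'a::comm_ring_1 plane set" where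
  "supported S = {p. Poly_Mapping.keys p \<subseteq> S}"

lemma supported_iff: "p \<in> supported S \<longleftrightarrow> (\<forall>m. m \<notin> S \<longrightarrow> Poly_Mapping.lookup p m = 0)"
  by (auto simp: supported_def in_keys_iff)

lemma subspace_supported: "plane.subspace (supported S)"
  by (auto simp: plane.subspace_def supported_iff lookup_add)

lemma mon_mem_supported_iff [simp]: "mon m \<in> supported S \<longleftrightarrow> m \<in> S"
  by (simp add: supported_def)

lemma supported_mono: "S \<subseteq> S' \<Longrightarrow> supported S \<subseteq> supported S'"
  by (auto simp: supported_def)

lemma supported_Int: "supported S \<inter> supported S' = supported (S \<inter> S')"
  by (auto simp: supported_def)

lemma supported_inject: "supported S = (supported S' :: 'a::comm_ring_1 plane set) \<longleftrightarrow> S = S'"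
  by (metis mon_mem_supported_iff set_eqI)

lemma span_mon: "plane.span (mon ` S) = (supported S :: 'a::comm_ring_1 plane set)"
proof (rule plane.span_subspace)
  show "mon ` S \<subseteq> (supported S :: 'a plane set)"
    by auto
  show "(supported S :: 'a plane set) \<subseteq> plane.span (mon ` S)"
  proof
    fix p :: "'a plane"
    assume "p \<in> supported S"
    then have "(\<Sum>m\<in>Poly_Mapping.keys p. scl (Poly_Mapping.lookup p m) (mon m))
        \<in> plane.span (mon ` S)"
      by (intro plane.span_sum plane.span_scale plane.span_base) (auto simp: supported_def)
    then show "p \<in> plane.span (mon ` S)"
      using plane_expansion[of p] by simp
  qed
qed (rule subspace_supported)

lemma supported_subset_iff:
  assumes "plane.subspace J"
  shows "supported S \<subseteq> J \<longleftrightarrow> mon ` S \<subseteq> J"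
  using assms by (metis plane.span_minimal plane.span_superset span_mon subset_trans)

definition restr :: "(nat \<times> nat) set \<Rightarrow> 'a::comm_ring_1 plane \<Rightarrow> 'a plane" where
  "restr S = weight_act (\<lambda>m. if m \<in> S then 1 else 0)"

lemma lookup_restr [simp]:
  "Poly_Mapping.lookup (restr S p) m = (if m \<in> S then Poly_Mapping.lookup p m else 0)"
  by (simp add: restr_def)

lemma restr_0 [simp]: "restr S 0 = 0"
  by (simp add: restr_def)

lemma restr_add: "restr S (p + q) = restr S p + restr S q"
  by (simp add: restr_def weight_act_add)

lemma restr_diff: "restr S (p - q) = restr S p - restr S q"
  by (simp add: restr_def weight_act_diff)

lemma restr_scl: "restr S (scl c p) = scl c (restr S p)"
  by (simp add: restr_def weight_act_scl)

lemma restr_sum: "restr S (\<Sum>i\<in>A. f i) = (\<Sum>i\<in>A. restr S (f i))"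
  by (simp add: restr_def weight_act_sum)

lemma restr_weight_act: "restr S (weight_act w p) = weight_act w (restr S p)"
  unfolding restr_def by (rule weight_act_commute)

lemma restr_mon: "restr S (mon m) = (if m \<in> S then mon m else 0)"
  by (rule poly_mapping_eqI) (simp add: lookup_mon)

lemma restr_eq_sum_mon:
  assumes "finite S"
  shows "restr S p = (\<Sum>m\<in>S. scl (Poly_Mapping.lookup p m) (mon m))"
  using assms
  by (intro poly_mapping_eqI)
    (simp add: lookup_sum lookup_mon if_distrib[of "\<lambda>x. _ * x"] cong: if_cong)

lemma restr_mem_supported [simp]: "restr S p \<in> supported S"
  by (simp add: supported_iff)

lemma restr_eq_self: "restr S p = p \<longleftrightarrow> p \<in> supported S"
  by (auto simp: supported_iff poly_mapping_eq_iff fun_eq_iff)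

lemma restr_eq_0: "p \<in> supported S \<Longrightarrow> S \<inter> S' = {} \<Longrightarrow> restr S' p = 0"
  by (rule poly_mapping_eqI) (auto simp: supported_iff)

lemma minus_restr_mem_supported: "p \<in> supported S \<Longrightarrow> p - restr S' p \<in> supported (S - S')"
  by (auto simp: supported_iff lookup_minus)

lemma weight_act_mem_supported: "p \<in> supported S \<Longrightarrow> weight_act w p \<in> supported S"
  by (auto simp: supported_iff)

text \<open>
  Shifting by an exponent in \<open>A\<close> pulls \<open>S\<close> back to \<open>S'\<close>, so projecting after the multiplication
  amounts to projecting before it.
\<close>

lemma restr_mult_left:
  assumes r: "r \<in> supported A"
    and A: "\<And>a m. a \<in> A \<Longrightarrow> a + m \<in> S \<longleftrightarrow> m \<in> S'"
  shows "restr S (r * p) = r * restr S' p"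
proof -
  have mono: "restr S (mon a * p) = mon a * restr S' p" if "a \<in> A" for a
  proof (rule poly_mapping_eqI)
    fix k
    show "Poly_Mapping.lookup (restr S (mon a * p)) k = Poly_Mapping.lookup (mon a * restr S' p) k"
    proof (cases "k \<in> range ((+) a)")
      case True
      then obtain m where k: "k = a + m" by blast
      show ?thesis unfolding k lookup_restr lookup_mon_times_add using A[OF that, of m] by simp
    next
      case False
      then show ?thesis by (simp add: lookup_mon_times_outside)
    qed
  qed
  have "restr S (r * p) = restr S ((\<Sum>a\<in>Poly_Mapping.keys r. scl (Poly_Mapping.lookup r a) (mon a)) * p)"
    using plane_expansion[of r] by simp
  also have "\<dots> = (\<Sum>a\<in>Poly_Mapping.keys r. scl (Poly_Mapping.lookup r a) (mon a) * restr S' p)"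
    unfolding sum_distrib_right restr_sum
  proof (rule sum.cong)
    fix a assume "a \<in> Poly_Mapping.keys r"
    then have "a \<in> A" using r by (auto simp: supported_def)
    then show "restr S (scl (Poly_Mapping.lookup r a) (mon a) * p) =
        scl (Poly_Mapping.lookup r a) (mon a) * restr S' p"
      by (simp add: scl_times_left restr_scl mono)
  qed simp
  also have "\<dots> = r * restr S' p"
    unfolding sum_distrib_right[symmetric] using plane_expansion[of r] by simp
  finally show ?thesis .
qed

lemma restr_mem_span:
  assumes "\<And>x. x \<in> X \<Longrightarrow> restr S x \<in> plane.span Y" "p \<in> plane.span X"
  shows "restr S p \<in> plane.span Y"
  using assms(2)
proof (rule plane.span_induct)
  show "plane.subspace {p. restr S p \<in> plane.span Y}"
    by (rule plane.subspaceI) (simp_all add: plane.span_zero restr_add plane.span_add restr_scl plane.span_scale)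
qed (rule assms(1))

text \<open>
  Applying the operators \<open>weight_act w - z\<close>, for all the other values \<open>z\<close> of \<open>w\<close> on the monomials of
  \<open>p\<close>, kills every other component of \<open>p\<close> and multiplies the wanted one by a product of units. This
  is diagonalisation over a ring: eigenvalues have to differ by units, not merely to be distinct.
\<close>

lemma weight_component_mem:
  assumes J: "plane.subspace J"
    and stable: "\<And>p. p \<in> J \<Longrightarrow> weight_act w p \<in> J"
    and unit: "\<And>m m'. w m \<noteq> w m' \<Longrightarrow> (w m - w m') dvd 1"
    and p: "p \<in> J"
  shows "restr {m. w m = w m\<^sub>0} p \<in> J"
proof -
  define Z where "Z = w ` Poly_Mapping.keys p - {w m\<^sub>0}"
  \<comment> \<open>By induction on the set of factors, since \<open>w - z\<close> maps \<open>J\<close> to itself.\<close>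
  have product: "weight_act (\<lambda>m. \<Prod>z\<in>A. w m - z) p \<in> J" if "finite A" for A
    using that
  proof induct
    case empty
    have "weight_act (\<lambda>m. 1) p = p" by (rule poly_mapping_eqI) simp
    then show ?case using p by simp
  next
    case (insert z A)
    let ?q = "weight_act (\<lambda>m. \<Prod>z\<in>A. w m - z) p"
    have "weight_act (\<lambda>m. \<Prod>z\<in>insert z A. w m - z) p = weight_act w ?q - scl z ?q"
      by (rule poly_mapping_eqI) (use insert in \<open>simp add: lookup_minus algebra_simps\<close>)
    then show ?case
      using insert J stable by (simp add: plane.subspace_diff plane.subspace_scale)
  qed
  have "finite Z" by (simp add: Z_def)
  have "(\<Prod>z\<in>A. w m\<^sub>0 - z) dvd 1" if "finite A" "A \<subseteq> Z" for A
    using that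
  proof induct
    case (insert z A)
    then have "(w m\<^sub>0 - z) dvd 1"
      unfolding Z_def by (metis DiffE imageE insertCI insert_subset unit)
    then show ?case using insert mult_dvd_mono[of "w m\<^sub>0 - z" 1 "\<Prod>z\<in>A. w m\<^sub>0 - z" 1] by simp
  qed simp
  then obtain u where u: "u * (\<Prod>z\<in>Z. w m\<^sub>0 - z) = 1"
    using \<open>finite Z\<close> by (metis dvd_def mult.commute order_refl)
  have "restr {m. w m = w m\<^sub>0} p = scl u (weight_act (\<lambda>m. \<Prod>z\<in>Z. w m - z) p)"
  proof (rule poly_mapping_eqI)
    fix m
    consider "w m = w m\<^sub>0" | "m \<notin> Poly_Mapping.keys p" | "w m \<in> Z"
      unfolding Z_def by blast
    then show "Poly_Mapping.lookup (restr {m. w m = w m\<^sub>0} p) m =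
        Poly_Mapping.lookup (scl u (weight_act (\<lambda>m. \<Prod>z\<in>Z. w m - z) p)) m"
    proof cases
      case 1
      then show ?thesis using u by (simp add: mult.assoc[symmetric])
    next
      case 2
      then show ?thesis by (simp add: in_keys_iff)
    next
      case 3
      then have "(\<Prod>z\<in>Z. w m - z) = 0" "w m \<noteq> w m\<^sub>0"
        using \<open>finite Z\<close> by (auto simp: Z_def intro!: prod_zero)
      then show ?thesis by simp
    qed
  qed
  then show ?thesis
    using product[OF \<open>finite Z\<close>] J by (simp add: plane.subspace_scale)
qed

section \<open>Isotypic components and labels\<close>

lemma ring_hom_0: "is_ring_hom h \<Longrightarrow> h 0 = 0"
  by (metis add_cancel_right_left is_ring_hom_def)

lemma ring_hom_minus: "is_ring_hom h \<Longrightarrow> h (x - y) = h x - h y"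
  by (metis add_diff_cancel_right' diff_add_cancel is_ring_hom_def)

lemma ring_hom_power: "is_ring_hom h \<Longrightarrow> h (x ^ k) = h x ^ k"
  by (induct k) (simp_all add: is_ring_hom_def)

lemma ring_hom_unit:
  assumes "is_ring_hom h" "z \<noteq> 0"
  shows "h (z :: 'f::field) dvd 1"
proof -
  have "h z * h (inverse z) = 1"
    using assms unfolding is_ring_hom_def by (metis right_inverse)
  then show ?thesis by (metis dvdI)
qed

lemma is_ring_hom_id: "is_ring_hom id"
  by (simp add: is_ring_hom_def)

lemma is_ring_hom_comp: "is_ring_hom g \<Longrightarrow> is_ring_hom f \<Longrightarrow> is_ring_hom (g \<circ> f)"
  by (simp add: is_ring_hom_def)

lemma label_eq_iff:
  "label n (a, b) = label n (a', b') \<longleftrightarrow>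
    (int a - int b) mod (int n + 1) = (int a' - int b') mod (int n + 1)"
  by (simp add: label_def eq_nat_nat_iff)

lemma label_le: "label n m \<le> n"
proof -
  have "(int (fst m) - int (snd m)) mod (int n + 1) < int n + 1"
    by (rule pos_mod_bound) simp
  then have "(int (fst m) - int (snd m)) mod (int n + 1) \<le> int n" by linarith
  then show ?thesis by (simp only: label_def case_prod_unfold nat_le_iff)
qed

lemma label_column: "i \<le> n \<Longrightarrow> label n (i, 0) = i"
  by (simp add: label_def)

lemma label_add_left_iff: "label n (d + m) = label n (d + m') \<longleftrightarrow> label n m = label n m'"
proof -
  obtain a b where d: "d = (a, b)" by fastforce
  obtain p q p' q' where m: "m = (p, q)" "m' = (p', q')" by fastforce
  have "(x + y) mod k = (x + y') mod k \<longleftrightarrow> y mod k = y' mod k" for x y y' k :: int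
    by (simp add: mod_eq_dvd_iff)
  from this[of "int a - int b" "int p - int q" "int n + 1" "int p' - int q'"] show ?thesis
    by (simp add: d m label_eq_iff algebra_simps)
qed

lemma label_0: "label n 0 = 0"
  by (simp add: label_def zero_prod_def)

lemma label_eq_0_iff: "label n (a, b) = 0 \<longleftrightarrow> (int a - int b) mod (int n + 1) = 0"
  using label_eq_iff[of n a b 0 0] label_0[of n] by (simp add: zero_prod_def)

lemma label_add_invariant: "label n d = 0 \<Longrightarrow> label n (d + m) = label n m"
  using label_add_left_iff[of n m d 0] by (simp add: label_0 add.commute)

text \<open>
  The group element \<open>(\<zeta>, \<zeta>\<^sup>-\<^sup>1)\<close> scales \<open>x\<^sup>a y\<^sup>b\<close> by \<open>\<zeta>\<close> to the power \<open>a - b\<close>, which depends on the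
  residue of \<open>a - b\<close> alone.
\<close>

lemma root_power_label:
  assumes "\<zeta> ^ (n + 1) = (1::complex)"
  shows "\<zeta> ^ a * inverse \<zeta> ^ b = \<zeta> ^ label n (a, b)"
proof -
  have mod: "\<zeta> ^ k = \<zeta> ^ (k mod (n + 1))" for k
  proof -
    have "\<zeta> ^ k = (\<zeta> ^ (n + 1)) ^ (k div (n + 1)) * \<zeta> ^ (k mod (n + 1))"
      by (simp only: power_mult[symmetric] power_add[symmetric] mult_div_mod_eq)
    also have "\<dots> = \<zeta> ^ (k mod (n + 1))"
      unfolding assms by simp
    finally show ?thesis .
  qed
  have "int (a mod (n + 1)) = int ((label n (a, b) + b) mod (n + 1))"
    by (simp add: label_def zmod_int mod_simps add.commute)
  then have "\<zeta> ^ a = \<zeta> ^ label n (a, b) * \<zeta> ^ b"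
    unfolding power_add[symmetric] by (metis mod of_nat_eq_iff)
  moreover have "\<zeta> \<noteq> 0" using assms by auto
  ultimately show ?thesis by (simp add: power_inverse field_simps)
qed

lemma gam_act_eq_weight_act:
  assumes "is_ring_hom alg" "\<gamma> \<in> Gam n"
  shows "gam_act alg \<gamma> = weight_act (\<lambda>m. alg (rho (label n m) \<gamma>))"
proof -
  obtain \<zeta> where \<gamma>: "\<gamma> = (\<zeta>, inverse \<zeta>)" "\<zeta> ^ (n + 1) = 1"
    using assms(2) by (auto simp: Gam_def)
  have "alg \<zeta> ^ a * alg (inverse \<zeta>) ^ b = alg (\<zeta> ^ label n (a, b))" for a b
    using assms(1) root_power_label[OF \<gamma>(2), of a b]
    by (metis ring_hom_power is_ring_hom_def)
  then show ?thesis
    by (simp add: gam_act_def \<gamma>(1) torus_act_eq_weight_act rho_def case_prod_unfold)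
qed

text \<open>
  A primitive root of unity separates the characters.
\<close>

lemma separating_group_element_exists: "\<exists>\<gamma>\<in>Gam n. \<forall>i\<le>n. \<forall>j\<le>n. rho i \<gamma> = rho j \<gamma> \<longrightarrow> i = j"
proof -
  define \<zeta> where "\<zeta> = cis (2 * pi / real (n + 1))"
  have pow: "\<zeta> ^ k = cis (2 * pi * real k / real (n + 1))" for k
    by (simp add: \<zeta>_def Complex.DeMoivre mult.commute mult.left_commute)
  have "inj_on (\<lambda>k. cis (2 * pi * real k / real (n + 1))) {..<n + 1}"
    using bij_betw_roots_unity[of "n + 1"] by (simp add: bij_betw_def)
  then have "inj_on (\<lambda>k. \<zeta> ^ k) {..<n + 1}" by (simp only: pow)
  moreover have "\<zeta> ^ (n + 1) = 1" unfolding pow by simp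
  ultimately show ?thesis
    unfolding Gam_def rho_def by (intro bexI[of _ "(\<zeta>, inverse \<zeta>)"]) (auto simp: inj_on_def less_Suc_eq_le)
qed

text \<open>
  Eigenvalues of the group differ by images of nonzero complex numbers, and these are units in every
  \<open>\<complex>\<close>-algebra; hence \<open>weight_component_mem\<close> applies over all of them.
\<close>

lemma alg_rho_diff_unit:
  assumes "is_ring_hom alg" "rho i \<gamma> \<noteq> rho j \<gamma>"
  shows "(alg (rho i \<gamma>) - alg (rho j \<gamma>)) dvd 1"
  using ring_hom_unit[OF assms(1), of "rho i \<gamma> - rho j \<gamma>"] assms by (simp add: ring_hom_minus)

lemma unit_mult_eq_0: "u dvd 1 \<Longrightarrow> u * c = 0 \<Longrightarrow> c = (0 :: 'a::comm_ring_1)"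
  by (metis dvdE mult.assoc mult.commute mult_1 mult_zero_right)

text \<open>
  A coefficient at a monomial of a different label is annihilated by a difference of two distinct
  roots of unity, hence by a unit.
\<close>

lemma isotypic_eq_supported:
  assumes "is_ring_hom alg" "i \<le> n"
  shows "isotypic n alg i = supported (label n -` {i})"
proof (intro set_eqI iffI)
  fix p :: "'a plane"
  assume p: "p \<in> isotypic n alg i"
  obtain \<gamma> where \<gamma>: "\<gamma> \<in> Gam n" and sep: "\<And>i j. i \<le> n \<Longrightarrow> j \<le> n \<Longrightarrow> rho i \<gamma> = rho j \<gamma> \<Longrightarrow> i = j"
    using separating_group_element_exists[of n] by metis
  have "Poly_Mapping.lookup p m = 0" if "label n m \<noteq> i" for m
  proof -
    have "alg (rho (label n m) \<gamma>) * Poly_Mapping.lookup p m = alg (rho i \<gamma>) * Poly_Mapping.lookup p m"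
      using p \<gamma> gam_act_eq_weight_act[OF assms(1) \<gamma>] unfolding isotypic_def
      by (metis (mono_tags, lifting) lookup_scl lookup_weight_act mem_Collect_eq)
    then have "(alg (rho (label n m) \<gamma>) - alg (rho i \<gamma>)) * Poly_Mapping.lookup p m = 0"
      by (simp add: left_diff_distrib)
    then show ?thesis
      using unit_mult_eq_0 alg_rho_diff_unit[OF assms(1)] sep[OF label_le \<open>i \<le> n\<close>] that by metis
  qed
  then show "p \<in> supported (label n -` {i})" by (auto simp: supported_iff)
next
  fix p :: "'a plane"
  assume "p \<in> supported (label n -` {i})"
  then have "gam_act alg \<gamma> p = scl (alg (rho i \<gamma>)) p" if "\<gamma> \<in> Gam n" for \<gamma>
    unfolding gam_act_eq_weight_act[OF assms(1) that]
    using \<open>p \<in> supported (label n -` {i})\<close>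
    by (intro poly_mapping_eqI, rename_tac m, case_tac "label n m = i") (simp_all add: supported_iff del: split_paired_All)
  then show "p \<in> isotypic n alg i" by (simp add: isotypic_def)
qed

lemma invariant_ring_eq_supported: "invariant_ring n = supported (label n -` {0})"
proof -
  have "invariant_ring n = isotypic n id 0"
    by (auto simp: invariant_ring_def isotypic_def rho_def scl_def)
  then show ?thesis by (simp add: isotypic_eq_supported[OF is_ring_hom_id])
qed

definition homogeneous :: "nat \<Rightarrow> 'a::comm_ring_1 plane set \<Rightarrow> bool" where
  "homogeneous n J \<longleftrightarrow> plane.subspace J \<and> (\<forall>p\<in>J. \<forall>i. restr (label n -` {i}) p \<in> J)"

text \<open>
  The level sets of the weight of a separating group element are the sets of monomials with a common
  label, so weight separation can be applied to this single element.
\<close>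

lemma homogeneous_if_Gam_invariant:
  assumes "is_ring_hom alg" "plane.subspace J" "\<forall>\<gamma>\<in>Gam n. gam_act alg \<gamma> ` J \<subseteq> J"
  shows "homogeneous n J"
proof -
  obtain \<gamma> where \<gamma>: "\<gamma> \<in> Gam n" and sep: "\<And>i j. i \<le> n \<Longrightarrow> j \<le> n \<Longrightarrow> rho i \<gamma> = rho j \<gamma> \<Longrightarrow> i = j"
    using separating_group_element_exists[of n] by metis
  define w where "w m = alg (rho (label n m) \<gamma>)" for m
  have act: "gam_act alg \<gamma> = weight_act w"
    using gam_act_eq_weight_act[OF assms(1) \<gamma>] by (simp add: w_def[abs_def])
  have weq: "w m = w m' \<longleftrightarrow> label n m = label n m'" for m m'
  proof
    assume eq: "w m = w m'"
    have "\<not> (0 :: 'a) dvd 1" by simp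
    then have "rho (label n m) \<gamma> = rho (label n m') \<gamma>"
      using alg_rho_diff_unit[OF assms(1), of "label n m" \<gamma> "label n m'"] eq by (auto simp: w_def)
    then show "label n m = label n m'" using sep label_le by blast
  qed (simp add: w_def)
  have "restr (label n -` {i}) p \<in> J" if p: "p \<in> J" for p i
  proof (cases "i \<le> n")
    case True
    have "restr {m. w m = w (i, 0)} p \<in> J"
    proof (rule weight_component_mem[OF assms(2)])
      show "weight_act w q \<in> J" if "q \<in> J" for q
        using assms(3) \<gamma> that unfolding act[symmetric] by auto
      show "(w m - w m') dvd 1" if "w m \<noteq> w m'" for m m'
        using that unfolding w_def by (intro alg_rho_diff_unit assms(1)) auto
    qed (rule p)
    moreover have "{m. w m = w (i, 0)} = label n -` {i}"
      using True by (auto simp: weq label_column)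
    ultimately show ?thesis by simp
  next
    case False
    then have "restr (label n -` {i}) p = 0"
      using label_le by (intro poly_mapping_eqI) auto
    then show ?thesis using assms(2) by (simp add: plane.subspace_0)
  qed
  then show ?thesis using assms(2) by (simp add: homogeneous_def)
qed

lemma homogeneous_UNIV: "homogeneous n UNIV"
  by (simp add: homogeneous_def)

lemma sum_restr_labels:
  assumes "finite A" "p \<in> supported (label n -` A)"
  shows "(\<Sum>i\<in>A. restr (label n -` {i}) p) = p"
  by (rule poly_mapping_eqI) (use assms in \<open>auto simp: lookup_sum supported_iff\<close>)

lemma homogeneous_restr:
  assumes "homogeneous n J" "finite A" "p \<in> J"
  shows "restr (label n -` A) p \<in> J"
proof -
  have "restr (label n -` A) p = (\<Sum>i\<in>A. restr (label n -` {i}) p)"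
    using assms(2) by (intro poly_mapping_eqI) (simp add: lookup_sum)
  then show ?thesis
    using assms by (auto simp: homogeneous_def intro: plane.subspace_sum)
qed

text \<open>
  For \<open>J = UNIV\<close> this computes \<open>R\<^bsub>I+\<^esub> \<otimes> A\<close>, and for an ideal \<open>J\<close> its image under the morphism. From
  here on the morphism is an intersection with a fixed span of monomials.
\<close>

lemma sum_of_isotypic:
  assumes "is_ring_hom alg" "homogeneous n J" "Ip \<subseteq> {0..n}"
  shows "sum_of Ip (\<lambda>i. J \<inter> isotypic n alg i) = J \<inter> supported (label n -` Ip)"
proof -
  have iso: "isotypic n alg i = supported (label n -` {i})" if "i \<in> Ip" for i
    using that assms by (intro isotypic_eq_supported) auto
  have fin: "finite Ip" using assms(3) finite_subset by blast
  have J: "plane.subspace J" using assms(2) by (simp add: homogeneous_def)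
  show ?thesis
  proof (intro set_eqI iffI)
    fix p assume "p \<in> sum_of Ip (\<lambda>i. J \<inter> isotypic n alg i)"
    then obtain q where p: "p = (\<Sum>i\<in>Ip. q i)" and q: "\<And>i. i \<in> Ip \<Longrightarrow> q i \<in> J \<inter> supported (label n -` {i})"
      using iso by (auto simp: sum_of_def)
    have "q i \<in> J \<inter> supported (label n -` Ip)" if "i \<in> Ip" for i
      using q[OF that] supported_mono[of "label n -` {i}" "label n -` Ip"] that by auto
    then show "p \<in> J \<inter> supported (label n -` Ip)"
      unfolding p by (intro plane.subspace_sum plane.subspace_inter J subspace_supported)
  next
    fix p assume p: "p \<in> J \<inter> supported (label n -` Ip)"
    then have "p = (\<Sum>i\<in>Ip. restr (label n -` {i}) p)"
      using sum_restr_labels[OF fin, of p n] by simp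
    moreover have "\<forall>i\<in>Ip. restr (label n -` {i}) p \<in> J \<inter> isotypic n alg i"
      using p assms(2) by (auto simp: homogeneous_def iso)
    ultimately show "p \<in> sum_of Ip (\<lambda>i. J \<inter> isotypic n alg i)"
      unfolding sum_of_def by (smt (verit, best) mem_Collect_eq)
  qed
qed

lemma R_plus_eq_supported:
  assumes "is_ring_hom alg" "Ip \<subseteq> {0..n}"
  shows "R_plus n Ip alg = supported (label n -` Ip)"
  using sum_of_isotypic[OF assms(1) homogeneous_UNIV assms(2)] by (simp add: R_plus_def)

lemma hilb_to_quot_eq:
  assumes "is_ring_hom alg" "homogeneous n J" "Ip \<subseteq> {0..n}"
  shows "hilb_to_quot n Ip alg J = J \<inter> supported (label n -` Ip)"
  using sum_of_isotypic[OF assms] by (simp add: hilb_to_quot_def)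

section \<open>Endomorphisms of the sum of isotypic components\<close>

lemma lookup_map_ring_hom:
  assumes "is_ring_hom h"
  shows "Poly_Mapping.lookup (Poly_Mapping.map h p) m = h (Poly_Mapping.lookup p m)"
  using ring_hom_0[OF assms] by (auto simp: map.rep_eq when_def)

lemma map_ring_hom_mon: "is_ring_hom h \<Longrightarrow> Poly_Mapping.map h (mon m) = mon m"
  by (rule poly_mapping_eqI) (auto simp: lookup_map_ring_hom lookup_mon ring_hom_0 is_ring_hom_def)

lemma map_ring_hom_restr:
  "is_ring_hom h \<Longrightarrow> Poly_Mapping.map h (restr S p) = restr S (Poly_Mapping.map h p)"
  by (rule poly_mapping_eqI) (simp add: lookup_map_ring_hom ring_hom_0)

lemma map_ring_hom_0: "is_ring_hom h \<Longrightarrow> Poly_Mapping.map h 0 = 0"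
  by (rule poly_mapping_eqI) (simp add: lookup_map_ring_hom ring_hom_0)

lemma map_ring_hom_mon_times:
  assumes "is_ring_hom h"
  shows "Poly_Mapping.map h (mon m * p) = mon m * Poly_Mapping.map h p"
proof (rule poly_mapping_eqI)
  fix k
  show "Poly_Mapping.lookup (Poly_Mapping.map h (mon m * p)) k =
      Poly_Mapping.lookup (mon m * Poly_Mapping.map h p) k"
  proof (cases "k \<in> range ((+) m)")
    case True
    then obtain m' where "k = m + m'" by blast
    then show ?thesis by (simp add: lookup_map_ring_hom[OF assms])
  next
    case False
    then show ?thesis
      by (simp add: lookup_map_ring_hom[OF assms] lookup_mon_times_outside ring_hom_0[OF assms])
  qed
qed

lemma mon_times_mem_supported:
  assumes "p \<in> supported S" "\<And>m. m \<in> S \<Longrightarrow> d + m \<in> S'"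
  shows "mon d * p \<in> supported S'"
proof -
  have "Poly_Mapping.keys (mon d * p) \<subseteq> (+) d ` Poly_Mapping.keys p"
    using keys_mult[of "mon d" p] unfolding keys_mon by blast
  then show ?thesis using assms unfolding supported_def by blast
qed

lemma mon_factor:
  assumes "p \<in> supported (range ((+) e))"
  shows "\<exists>g. p = mon e * g"
proof (intro exI poly_mapping_eqI)
  fix k
  have inj: "inj ((+) e)" by simp
  show "Poly_Mapping.lookup p k = Poly_Mapping.lookup (mon e * Poly_Mapping.map_key ((+) e) p) k"
  proof (cases "k \<in> range ((+) e)")
    case True
    then obtain m where "k = e + m" by blast
    then show ?thesis by (simp add: map_key.rep_eq[OF inj])
  next
    case False
    then show ?thesis
      using assms by (simp add: supported_iff lookup_mon_times_outside del: split_paired_All)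
  qed
qed

text \<open>
  Over the invariants, \<open>R\<^sub>i\<close> is generated by \<open>x\<^sup>i\<close> and \<open>y\<close> to the power \<open>n + 1 - i\<close>. The relation
  \<open>y\<^sup>n\<^sup>+\<^sup>1 x\<^sup>i = (x y)\<^sup>i y\<^sup>n\<^sup>+\<^sup>1\<^sup>-\<^sup>i\<close> between them forces \<open>x\<^sup>i\<close> to divide \<open>\<phi> (x\<^sup>i)\<close>; let \<open>g\<close> be the quotient. For
  every monomial \<open>m\<close> of label \<open>i\<close> the product \<open>(x y)\<^sup>i m\<close> is \<open>x\<^sup>i\<close> times an invariant monomial, and
  cancelling \<open>(x y)\<^sup>i\<close> shows that \<open>\<phi>\<close> multiplies \<open>m\<close> by the same \<open>g\<close>.
\<close>

lemma B_plus_is_multiplication: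
  assumes Ip: "Ip \<subseteq> {0..n}" and \<phi>: "\<phi> \<in> B_plus n Ip" and i: "i \<in> Ip"
  obtains g where "\<And>m. label n m = i \<Longrightarrow> \<phi> (mon m) = mon m * g"
proof -
  have lin: "mon d * \<phi> (mon m) = \<phi> (mon (d + m))" if "label n d = 0" "label n m = i" for d m
    using \<phi> i that
    by (simp add: B_plus_def R_plus_eq_supported[OF is_ring_hom_id Ip] invariant_ring_eq_supported
        mon_times_mon[symmetric])
  define e where "e = (i, 0::nat)"
  have i_le: "i \<le> n" using i Ip by auto
  have e: "label n e = i" using i_le by (simp add: e_def label_column)
  have diag: "label n (i, i) = 0" by (simp add: label_eq_0_iff)
  have "int 0 - int (n + 1) = - (int n + 1)" by simp
  then have col: "label n (0, n + 1) = 0"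
    by (simp only: label_eq_0_iff mod_eq_0_iff_dvd dvd_minus_iff dvd_refl)
  have f: "label n (0, n + 1 - i) = i"
  proof -
    have "int 0 - int (n + 1 - i) = int i - (int n + 1)"
      using i_le by linarith
    then have "(int 0 - int (n + 1 - i)) mod (int n + 1) = (int i - (int n + 1)) mod (int n + 1)"
      by (rule arg_cong)
    also have "\<dots> = (int i - int 0) mod (int n + 1)"
      by (simp only: minus_mod_self2 of_nat_0 diff_zero)
    finally have "label n (0, n + 1 - i) = label n (i, 0)" unfolding label_eq_iff .
    then show ?thesis using i_le label_column by simp
  qed
  have "(0, n + 1) + e = (i, i) + (0, n + 1 - i)"
    using i_le by (simp add: e_def)
  then have eq: "mon (0, n + 1) * \<phi> (mon e) = mon (i, i) * \<phi> (mon (0, n + 1 - i))"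
    by (simp only: lin[OF col e] lin[OF diag f])
  \<comment> \<open>The right-hand side of \<open>eq\<close> is divisible by \<open>x\<^sup>i\<close>, and \<open>y\<^sup>n\<^sup>+\<^sup>1\<close> is coprime to \<open>x\<^sup>i\<close>.\<close>
  have "\<phi> (mon e) \<in> supported (range ((+) e))"
    unfolding supported_iff
  proof (intro allI impI)
    fix m :: "nat \<times> nat" assume "m \<notin> range ((+) e)"
    then have "m \<noteq> e + (fst m - i, snd m)" by blast
    then have "fst m < i" by (cases m) (auto simp: e_def)
    then have "Poly_Mapping.lookup (mon (i, i) * \<phi> (mon (0, n + 1 - i))) ((0, n + 1) + m) = 0"
      by (intro lookup_mon_times_outside) (auto simp: prod_eq_iff)
    then show "Poly_Mapping.lookup (\<phi> (mon e)) m = 0"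
      by (simp only: eq[symmetric] lookup_mon_times_add)
  qed
  then obtain g where g: "\<phi> (mon e) = mon e * g" using mon_factor by blast
  show ?thesis
  proof
    fix m assume m: "label n m = i"
    obtain a b where ab: "m = (a, b)" by fastforce
    have "e + (a, b + i) = (i, i) + m" by (simp add: ab e_def)
    then have "label n (e + (a, b + i)) = label n (e + 0)"
      using label_add_invariant[OF diag, of m] m e by simp
    then have r: "label n (a, b + i) = 0"
      unfolding label_add_left_iff label_0 .
    \<comment> \<open>Both factors \<open>(i, i)\<close> and \<open>(a, b + i)\<close> are invariant, and \<open>(i, i) + m = (a, b + i) + e\<close>.\<close>
    have "mon (i, i) * \<phi> (mon m) = mon (a, b + i) * \<phi> (mon e)"
      unfolding lin[OF diag m] lin[OF r e] by (simp add: ab e_def add.commute)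
    also have "\<dots> = mon (i, i) * (mon m * g)"
      unfolding g mult.assoc[symmetric] mon_times_mon by (simp add: ab e_def add.commute)
    finally show "\<phi> (mon m) = mon m * g" by (simp add: mon_times_cancel)
  qed
qed

text \<open>
  A move projects to one isotypic component with label in \<open>I\<^sup>+\<close> and multiplies by a monomial that
  leads to a label in \<open>I\<^sup>+\<close> again. Over \<open>\<complex>\<close>, moves span the algebra \<open>B\<^bsub>I+\<^esub>\<close>. They have the advantage of
  being defined over every \<open>A\<close> and of being rescaled by the torus, whose elements may have coordinates in \<open>A\<close>
  and then do not act on \<open>B\<^bsub>I+\<^esub>\<close> itself.
\<close>

definition stable_under_moves :: "nat \<Rightarrow> nat set \<Rightarrow> 'a::comm_ring_1 plane set \<Rightarrow> bool" where
  "stable_under_moves n Ip K \<longleftrightarrow> (\<forall>p\<in>K. \<forall>d m. label n m \<in> Ip \<longrightarrow> label n (d + m) \<in> Ip \<longrightarrow>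
     mon d * restr (label n -` {label n m}) p \<in> K)"

lemma move_mem_B_plus:
  assumes Ip: "Ip \<subseteq> {0..n}" and "label n (d + m) \<in> Ip"
  shows "(\<lambda>p. mon d * restr (label n -` {label n m}) p) \<in> B_plus n Ip"
proof -
  have "mon d * restr (label n -` {label n m}) p \<in> supported (label n -` Ip)" for p :: "complex plane"
  proof (rule mon_times_mem_supported[OF restr_mem_supported])
    fix k assume "k \<in> label n -` {label n m}"
    then have "label n (d + k) = label n (d + m)" by (simp add: label_add_left_iff)
    then show "d + k \<in> label n -` Ip" using assms(2) by simp
  qed
  moreover have "restr (label n -` {label n m}) (r * p) = r * restr (label n -` {label n m}) p"
    if "r \<in> supported (label n -` {0})" for r p :: "complex plane"
    using that by (rule restr_mult_left) (simp add: label_add_invariant)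
  ultimately show ?thesis
    by (simp add: B_plus_def R_plus_eq_supported[OF is_ring_hom_id Ip] invariant_ring_eq_supported
        restr_add distrib_left mult.left_commute)
qed

lemma extend_move:
  assumes "is_ring_hom alg"
  shows "extend alg (\<lambda>p. mon d * restr S p) p = mon d * restr S p"
proof -
  have "Poly_Mapping.map alg (mon d * restr S (mon k)) = mon d * restr S (mon k)" for k
    by (simp add: restr_mon map_ring_hom_mon_times map_ring_hom_mon map_ring_hom_0 assms)
  then have "extend alg (\<lambda>p. mon d * restr S p) p =
      mon d * restr S (\<Sum>m\<in>Poly_Mapping.keys p. scl (Poly_Mapping.lookup p m) (mon m))"
    by (simp add: extend_def restr_sum sum_distrib_left restr_scl scl_times_right)
  then show ?thesis using plane_expansion[of p] by simp
qed

text \<open>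
  An endomorphism \<open>\<phi>\<close> multiplies \<open>R\<^sub>i\<close> by a polynomial \<open>g i\<close>, so after extension to \<open>A\<close> it is an
  \<open>A\<close>-linear combination of moves. These are moves inside \<open>I\<^sup>+\<close>: since \<open>\<phi>\<close> preserves \<open>R\<^bsub>I+\<^esub>\<close>, every
  monomial of \<open>g i\<close> leads from the label \<open>i\<close> to a label in \<open>I\<^sup>+\<close>.
\<close>

lemma B_plus_stable_iff_stable_under_moves:
  fixes K :: "'a::comm_ring_1 plane set"
  assumes alg: "is_ring_hom alg" and Ip: "Ip \<subseteq> {0..n}"
    and K: "plane.subspace K" "K \<subseteq> supported (label n -` Ip)"
  shows "(\<forall>\<phi>\<in>B_plus n Ip. extend alg \<phi> ` K \<subseteq> K) \<longleftrightarrow> stable_under_moves n Ip K"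
proof
  assume stable: "\<forall>\<phi>\<in>B_plus n Ip. extend alg \<phi> ` K \<subseteq> K"
  show "stable_under_moves n Ip K"
    unfolding stable_under_moves_def
  proof (intro ballI allI impI)
    fix p d m assume "p \<in> K" "label n m \<in> Ip" "label n (d + m) \<in> Ip"
    then have "extend alg (\<lambda>p. mon d * restr (label n -` {label n m}) p) p \<in> K"
      using stable move_mem_B_plus[OF Ip] by blast
    then show "mon d * restr (label n -` {label n m}) p \<in> K"
      by (simp only: extend_move[OF alg])
  qed
next
  assume moves: "stable_under_moves n Ip K"
  have fin: "finite Ip" using Ip finite_subset by blast
  show "\<forall>\<phi>\<in>B_plus n Ip. extend alg \<phi> ` K \<subseteq> K"
  proof (intro ballI subsetI, elim imageE)
    fix \<phi> q p assume \<phi>: "\<phi> \<in> B_plus n Ip" and p: "p \<in> K" and q: "q = extend alg \<phi> p"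
    have "\<forall>i\<in>Ip. \<exists>g. \<forall>m. label n m = i \<longrightarrow> \<phi> (mon m) = mon m * g"
      using B_plus_is_multiplication[OF Ip \<phi>] by metis
    then obtain g where g: "\<And>m. label n m \<in> Ip \<Longrightarrow> \<phi> (mon m) = mon m * g (label n m)"
      by metis
    define G where "G i = Poly_Mapping.map alg (g i)" for i
    have keys_p: "label n m \<in> Ip" if "m \<in> Poly_Mapping.keys p" for m
      using that p K(2) by (auto simp: supported_def)
    have G_label: "label n (d + m) \<in> Ip" if "label n m \<in> Ip" "d \<in> Poly_Mapping.keys (G (label n m))" for d m
    proof -
      have "Poly_Mapping.lookup (g (label n m)) d \<noteq> 0"
        using that(2) ring_hom_0[OF alg] by (auto simp: G_def in_keys_iff lookup_map_ring_hom[OF alg])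
      then have "m + d \<in> Poly_Mapping.keys (mon m * g (label n m))"
        by (simp add: in_keys_iff)
      moreover have "mon m * g (label n m) \<in> supported (label n -` Ip)"
        using \<phi> that(1) unfolding g[OF that(1), symmetric]
        by (simp add: B_plus_def R_plus_eq_supported[OF is_ring_hom_id Ip])
      ultimately show ?thesis by (auto simp: supported_def add.commute)
    qed
    let ?r = "\<lambda>i. restr (label n -` {i})"
    have mem: "G i * ?r i p \<in> K" if i: "i \<in> Ip" for i
    proof -
      obtain m where m: "label n m = i"
        using i Ip label_column[of i n] by force
      have "G i * ?r i p =
          (\<Sum>d\<in>Poly_Mapping.keys (G i). scl (Poly_Mapping.lookup (G i) d) (mon d)) * ?r i p"
        using plane_expansion[of "G i"] by simp
      also have "\<dots> = (\<Sum>d\<in>Poly_Mapping.keys (G i). scl (Poly_Mapping.lookup (G i) d) (mon d * ?r i p))"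
        by (simp add: sum_distrib_right scl_times_left)
      also have "\<dots> \<in> K"
        using moves p G_label m i unfolding stable_under_moves_def
        by (intro plane.subspace_sum plane.subspace_scale K(1)) blast
      finally show ?thesis .
    qed
    have mon_sum: "Poly_Mapping.map alg (\<phi> (mon m)) = (\<Sum>i\<in>Ip. G i * ?r i (mon m))"
      if "m \<in> Poly_Mapping.keys p" for m
    proof -
      have "(\<Sum>i\<in>Ip. G i * ?r i (mon m)) = (\<Sum>i\<in>Ip. if label n m = i then G i * mon m else 0)"
        by (intro sum.cong) (auto simp: restr_mon)
      also have "\<dots> = G (label n m) * mon m"
        using fin keys_p[OF that] by simp
      finally show ?thesis
        by (simp add: g[OF keys_p[OF that]] map_ring_hom_mon_times[OF alg] G_def mult.commute)
    qed
    have "q = (\<Sum>m\<in>Poly_Mapping.keys p. scl (Poly_Mapping.lookup p m) (\<Sum>i\<in>Ip. G i * ?r i (mon m)))"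
      using mon_sum by (simp add: q extend_def)
    also have "\<dots> = (\<Sum>i\<in>Ip. \<Sum>m\<in>Poly_Mapping.keys p. scl (Poly_Mapping.lookup p m) (G i * ?r i (mon m)))"
      unfolding plane.scale_sum_right by (rule sum.swap)
    also have "\<dots> = (\<Sum>i\<in>Ip. G i * ?r i (\<Sum>m\<in>Poly_Mapping.keys p. scl (Poly_Mapping.lookup p m) (mon m)))"
      by (simp add: restr_sum restr_scl sum_distrib_left scl_times_right)
    also have "\<dots> = (\<Sum>i\<in>Ip. G i * ?r i p)"
      using plane_expansion[of p] by simp
    also have "\<dots> \<in> K"
      using mem by (intro plane.subspace_sum K(1))
    finally show "q \<in> K" .
  qed
qed

section \<open>Local bases of isotypic components\<close>

text \<open>
  These polynomials form the kernel of the map to the localisation of \<open>A[x,y] / J\<close> at \<open>f\<close>. Working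
  modulo this kernel avoids keeping track of powers of \<open>f\<close>.
\<close>

lemma homogeneous_is_zero_at:
  assumes "homogeneous n J"
  shows "homogeneous n {p. is_zero_at f J p}"
proof -
  have J: "plane.subspace J" using assms by (simp add: homogeneous_def)
  have raise: "scl (f ^ (N + M)) p \<in> J" if "scl (f ^ N) p \<in> J" for N M p
    using plane.subspace_scale[OF J that, of "f ^ M"] by (simp add: power_add mult.commute)
  have "plane.subspace {p. is_zero_at f J p}"
  proof (rule plane.subspaceI)
    show "0 \<in> {p. is_zero_at f J p}"
      using J by (simp add: is_zero_at_def plane.subspace_0)
    fix p q c assume p: "p \<in> {p. is_zero_at f J p}"
    then obtain N where N: "scl (f ^ N) p \<in> J" by (auto simp: is_zero_at_def)
    have "scl (f ^ N) (scl c p) \<in> J"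
      using plane.subspace_scale[OF J N, of c] by (simp add: mult.commute)
    then show "scl c p \<in> {p. is_zero_at f J p}" by (auto simp: is_zero_at_def)
    assume "q \<in> {p. is_zero_at f J p}"
    then obtain M where "scl (f ^ M) q \<in> J" by (auto simp: is_zero_at_def)
    then have "scl (f ^ (N + M)) (p + q) \<in> J"
      using raise[OF N, of M] raise[of M q N] J
      by (simp add: plane.scale_right_distrib plane.subspace_add add.commute)
    then show "p + q \<in> {p. is_zero_at f J p}" by (auto simp: is_zero_at_def)
  qed
  moreover have "is_zero_at f J (restr (label n -` {i}) p)" if "is_zero_at f J p" for p i
    using that assms by (auto simp: is_zero_at_def homogeneous_def restr_scl[symmetric])
  ultimately show ?thesis by (simp add: homogeneous_def)
qed

text \<open>
  For a separating group element \<open>\<gamma>\<close>, the component with label \<open>l\<close> of \<open>\<gamma> p - \<rho>\<^sub>i(\<gamma>) p\<close> is that of \<open>p\<close>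
  multiplied by the unit \<open>\<rho>\<^sub>l(\<gamma>) - \<rho>\<^sub>i(\<gamma>)\<close>.
\<close>

lemma local_eigenvector_component:
  assumes alg: "is_ring_hom alg" and J: "homogeneous n J" and "i \<le> n"
    and eigen: "\<And>\<gamma>. \<gamma> \<in> Gam n \<Longrightarrow> gam_act alg \<gamma> p - scl (alg (rho i \<gamma>)) p \<in> J"
  shows "l \<noteq> i \<Longrightarrow> restr (label n -` {l}) p \<in> J" and "p - restr (label n -` {i}) p \<in> J"
proof -
  let ?r = "\<lambda>l. restr (label n -` {l})"
  have sub: "plane.subspace J" using J by (simp add: homogeneous_def)
  obtain \<gamma> where \<gamma>: "\<gamma> \<in> Gam n" and sep: "\<And>i j. i \<le> n \<Longrightarrow> j \<le> n \<Longrightarrow> rho i \<gamma> = rho j \<gamma> \<Longrightarrow> i = j"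
    using separating_group_element_exists[of n] by metis
  have other: "?r l p \<in> J" if "l \<noteq> i" for l
  proof (cases "l \<le> n")
    case True
    have "?r l (gam_act alg \<gamma> p - scl (alg (rho i \<gamma>)) p) \<in> J"
      using J eigen[OF \<gamma>] by (simp add: homogeneous_def)
    moreover have "?r l (gam_act alg \<gamma> p - scl (alg (rho i \<gamma>)) p) =
        scl (alg (rho l \<gamma>) - alg (rho i \<gamma>)) (?r l p)"
      unfolding gam_act_eq_weight_act[OF alg \<gamma>]
      by (rule poly_mapping_eqI) (simp add: lookup_minus left_diff_distrib)
    ultimately have mem: "scl (alg (rho l \<gamma>) - alg (rho i \<gamma>)) (?r l p) \<in> J" by simp
    have "(alg (rho l \<gamma>) - alg (rho i \<gamma>)) dvd 1"
      using sep[OF True \<open>i \<le> n\<close>] that by (intro alg_rho_diff_unit[OF alg]) blast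
    then obtain u where "u * (alg (rho l \<gamma>) - alg (rho i \<gamma>)) = 1" by (metis dvdE mult.commute)
    then show ?thesis using plane.subspace_scale[OF sub mem, of u] by simp
  next
    case False
    then have "?r l p = 0" using label_le by (intro poly_mapping_eqI) auto
    then show ?thesis using sub by (simp add: plane.subspace_0)
  qed
  show "?r l p \<in> J" if "l \<noteq> i" for l by (rule other[OF that])
  have "p \<in> supported (label n -` {0..n})"
    using label_le by (auto simp: supported_def)
  then have "p = (\<Sum>l\<in>{0..n}. ?r l p)"
    using sum_restr_labels[of "{0..n}" p n] by simp
  also have "\<dots> = ?r i p + (\<Sum>l\<in>{0..n} - {i}. ?r l p)"
    using \<open>i \<le> n\<close> by (intro sum.remove) auto
  finally have "p - ?r i p = (\<Sum>l\<in>{0..n} - {i}. ?r l p)" by (metis add_diff_cancel_left')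
  then show "p - ?r i p \<in> J"
    using other by (auto intro: plane.subspace_sum[OF sub])
qed

text \<open>
  In the localised quotient, \<open>b (i, k)\<close> agrees with its component of label \<open>i\<close>, whereas the component of
  label \<open>i\<close> of \<open>b (j, k)\<close> vanishes for \<open>j \<noteq> i\<close>. Hence the projection to label \<open>i\<close> turns an expansion in
  all of \<open>b\<close> into an expansion in the projected \<open>b (i, k)\<close>.
\<close>

lemma local_basis_isotypic:
  fixes alg :: "complex \<Rightarrow> 'a::comm_ring_1" and v :: "nat \<Rightarrow> nat"
  assumes alg: "is_ring_hom alg" and J: "homogeneous n J" and i: "i \<in> {0..n}"
    and K: "K \<subseteq> J" "J \<inter> supported (label n -` {i}) \<subseteq> K"
    and basis: "local_basis f UNIV J (SIGMA i:{0..n}. {..<v i}) b"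
    and eigen: "\<And>i k \<gamma>. i \<le> n \<Longrightarrow> k < v i \<Longrightarrow> \<gamma> \<in> Gam n \<Longrightarrow>
      is_zero_at f J (gam_act alg \<gamma> (b (i, k)) - scl (alg (rho i \<gamma>)) (b (i, k)))"
  shows "local_basis f (supported (label n -` {i})) K {..<v i} (\<lambda>k. restr (label n -` {i}) (b (i, k)))"
proof -
  let ?r = "restr (label n -` {i}) :: 'a plane \<Rightarrow> 'a plane"
  let ?S = "SIGMA i:{0..n}. {..<v i}"
  define Jf where "Jf = {p. is_zero_at f J p}"
  have sub: "plane.subspace J" using J by (simp add: homogeneous_def)
  have hom: "homogeneous n Jf" unfolding Jf_def by (rule homogeneous_is_zero_at[OF J])
  then have subf: "plane.subspace Jf" by (simp add: homogeneous_def)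
  have J_Jf: "p \<in> Jf" if "p \<in> J" for p
    unfolding Jf_def mem_Collect_eq is_zero_at_def using that by (intro exI[of _ 0]) simp
  have eig: "gam_act alg \<gamma> (b (i, k)) - scl (alg (rho i \<gamma>)) (b (i, k)) \<in> Jf"
    if "i \<le> n" "k < v i" "\<gamma> \<in> Gam n" for i k \<gamma>
    using eigen that by (simp add: Jf_def)
  have other: "?r (b (j, k)) \<in> Jf" if "j \<le> n" "k < v j" "j \<noteq> i" for j k
    using local_eigenvector_component(1)[OF alg hom that(1) eig[OF that(1,2)]] that by simp
  have self: "b (i, k) - ?r (b (i, k)) \<in> Jf" if "k < v i" for k
    using local_eigenvector_component(2)[OF alg hom _ eig[OF _ that]] i by simp
  have split: "(\<Sum>x\<in>?S. F x) = (\<Sum>k<v i. F (i, k)) + (\<Sum>x\<in>?S - {i} \<times> {..<v i}. F x)"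
    for F :: "nat \<times> nat \<Rightarrow> 'a plane"
  proof -
    have "(\<Sum>x\<in>?S. F x) = (\<Sum>x\<in>?S - {i} \<times> {..<v i}. F x) + (\<Sum>x\<in>{i} \<times> {..<v i}. F x)"
      using i by (intro sum.subset_diff) auto
    also have "(\<Sum>x\<in>{i} \<times> {..<v i}. F x) = (\<Sum>k<v i. F (i, k))"
      using sum.cartesian_product[of "\<lambda>i k. F (i, k)" "{..<v i}" "{i}"] by (simp add: case_prod_unfold)
    finally show ?thesis by (simp add: add.commute)
  qed
  have span: "\<exists>N c. scl (f ^ N) p - (\<Sum>k<v i. scl (c k) (?r (b (i, k)))) \<in> K"
    if p: "p \<in> supported (label n -` {i})" for p
  proof -
    obtain N c where "scl (f ^ N) p - (\<Sum>x\<in>?S. scl (c x) (b x)) \<in> J"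
      using basis unfolding local_basis_def by blast
    then have "?r (scl (f ^ N) p - (\<Sum>x\<in>?S. scl (c x) (b x))) \<in> J"
      using J by (simp add: homogeneous_def)
    moreover have "?r p = p" using p by (simp add: restr_eq_self)
    ultimately have "scl (f ^ N) p - (\<Sum>x\<in>?S. scl (c x) (?r (b x))) \<in> Jf"
      using J_Jf by (simp add: restr_diff restr_sum restr_scl)
    moreover have "(\<Sum>x\<in>?S - {i} \<times> {..<v i}. scl (c x) (?r (b x))) \<in> Jf"
    proof (intro plane.subspace_sum plane.subspace_scale subf)
      fix x assume x: "x \<in> ?S - {i} \<times> {..<v i}"
      obtain j k where "x = (j, k)" by fastforce
      then show "?r (b x) \<in> Jf" using x other[of j k] by auto
    qed
    ultimately have "scl (f ^ N) p - (\<Sum>k<v i. scl (c (i, k)) (?r (b (i, k)))) \<in> Jf"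
      using plane.subspace_add[OF subf] unfolding split[of "\<lambda>x. scl (c x) (?r (b x))"]
      by (smt (verit) add_diff_eq diff_add_cancel diff_diff_eq)
    then obtain M where M: "scl (f ^ M) (scl (f ^ N) p - (\<Sum>k<v i. scl (c (i, k)) (?r (b (i, k))))) \<in> J"
      by (auto simp: Jf_def is_zero_at_def)
    have eq: "scl (f ^ M) (scl (f ^ N) p - (\<Sum>k<v i. scl (c (i, k)) (?r (b (i, k))))) =
        scl (f ^ (M + N)) p - (\<Sum>k<v i. scl (f ^ M * c (i, k)) (?r (b (i, k))))"
      by (simp add: plane.scale_right_diff_distrib plane.scale_sum_right power_add)
    have "scl (f ^ (M + N)) p - (\<Sum>k<v i. scl (f ^ M * c (i, k)) (?r (b (i, k)))) \<in> supported (label n -` {i})"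
      by (intro plane.subspace_diff plane.subspace_sum plane.subspace_scale subspace_supported p
          restr_mem_supported)
    then have "scl (f ^ (M + N)) p - (\<Sum>k<v i. scl (f ^ M * c (i, k)) (?r (b (i, k)))) \<in> K"
      using M K(2) unfolding eq by blast
    then show ?thesis by (intro exI[of _ "M + N"] exI[of _ "\<lambda>k. f ^ M * c (i, k)"])
  qed
  have indep: "\<forall>k<v i. \<exists>N. f ^ N * c k = 0" if c: "(\<Sum>k<v i. scl (c k) (?r (b (i, k)))) \<in> K" for c
  proof (intro allI impI)
    fix k assume k: "k < v i"
    have "(\<Sum>k<v i. scl (c k) (?r (b (i, k)))) \<in> Jf" using c K(1) J_Jf by blast
    moreover have "(\<Sum>k<v i. scl (c k) (b (i, k) - ?r (b (i, k)))) \<in> Jf"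
      using self by (intro plane.subspace_sum plane.subspace_scale subf) auto
    ultimately have "(\<Sum>k<v i. scl (c k) (b (i, k))) \<in> Jf"
      using plane.subspace_add[OF subf]
      by (fastforce simp: plane.scale_right_diff_distrib sum_subtractf)
    then obtain M where M: "scl (f ^ M) (\<Sum>k<v i. scl (c k) (b (i, k))) \<in> J"
      by (auto simp: Jf_def is_zero_at_def)
    \<comment> \<open>The relation among the \<open>b (i, k)\<close>, extended by zero to all of \<open>b\<close>.\<close>
    define c' where "c' = (\<lambda>(j, k). if j = i then f ^ M * c k else 0)"
    have "(\<Sum>x\<in>?S - {i} \<times> {..<v i}. scl (c' x) (b x)) = 0"
    proof (intro sum.neutral ballI)
      fix x assume x: "x \<in> ?S - {i} \<times> {..<v i}"
      obtain j k where jk: "x = (j, k)" by fastforce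
      with x have "j \<noteq> i" by auto
      then show "scl (c' x) (b x) = 0" by (simp add: jk c'_def)
    qed
    then have "(\<Sum>x\<in>?S. scl (c' x) (b x)) = scl (f ^ M) (\<Sum>k<v i. scl (c k) (b (i, k)))"
      unfolding split by (simp add: c'_def plane.scale_sum_right)
    then have "(\<Sum>x\<in>?S. scl (c' x) (b x)) \<in> J" using M by simp
    then have "\<forall>x\<in>?S. \<exists>N. f ^ N * c' x = 0"
      using basis unfolding local_basis_def by blast
    moreover have "(i, k) \<in> ?S" using i k by simp
    ultimately obtain N where "f ^ N * c' (i, k) = 0" by blast
    then have "f ^ (N + M) * c k = 0" by (simp add: c'_def power_add mult.assoc)
    then show "\<exists>N. f ^ N * c k = 0" by blast
  qed
  show ?thesis
    unfolding local_basis_def using span indep by auto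
qed

section \<open>The morphism on families\<close>

lemma Hilb_subspace: "J \<in> Hilb n v alg \<Longrightarrow> plane.subspace J"
  by (auto simp: Hilb_def intro: subspace_ideal_imp_subspace_scl)

lemma Hilb_homogeneous: "is_ring_hom alg \<Longrightarrow> J \<in> Hilb n v alg \<Longrightarrow> homogeneous n J"
  using homogeneous_if_Gam_invariant[of alg J n] Hilb_subspace[of J n v alg]
  unfolding Hilb_def mem_Collect_eq by blast

lemma Quot_iff:
  fixes alg :: "complex \<Rightarrow> 'a::comm_ring_1"
  assumes "is_ring_hom alg" "Ip \<subseteq> {0..n}"
  shows "K \<in> Quot n Ip v alg \<longleftrightarrow>
    K \<subseteq> supported (label n -` Ip) \<and> plane.subspace K \<and> stable_under_moves n Ip K \<and>
    (\<forall>i\<in>Ip. \<exists>F. is_cover F \<and>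
      (\<forall>f\<in>F. \<exists>b. local_basis f (supported (label n -` {i})) K {..<v i} b))"
proof -
  have "isotypic n alg i = supported (label n -` {i})" if "i \<in> Ip" for i
    using that assms by (intro isotypic_eq_supported) auto
  then show ?thesis
    using B_plus_stable_iff_stable_under_moves[OF assms, of K]
    unfolding Quot_def mem_Collect_eq R_plus_eq_supported[OF assms] by (smt (verit, best))
qed

lemma ideal_stable_under_moves:
  assumes ideal: "module.subspace (*) J" and "homogeneous n J"
  shows "stable_under_moves n Ip (J \<inter> supported (label n -` Ip))"
  unfolding stable_under_moves_def
proof (intro ballI allI impI IntI)
  fix p d m assume p: "p \<in> J \<inter> supported (label n -` Ip)" and "label n (d + m) \<in> Ip"
  then show "mon d * restr (label n -` {label n m}) p \<in> J"
    using assms by (auto simp: homogeneous_def module.subspace_def[OF module_times])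
  show "mon d * restr (label n -` {label n m}) p \<in> supported (label n -` Ip)"
  proof (rule mon_times_mem_supported[OF restr_mem_supported])
    fix k assume "k \<in> label n -` {label n m}"
    then have "label n (d + k) = label n (d + m)" by (simp add: label_add_left_iff)
    then show "d + k \<in> label n -` Ip" using \<open>label n (d + m) \<in> Ip\<close> by simp
  qed
qed

lemma Hilb_local_basis_isotypic:
  fixes alg :: "complex \<Rightarrow> 'a::comm_ring_1"
  assumes alg: "is_ring_hom alg" and J: "J \<in> Hilb n v alg"
    and i: "i \<in> {0..n}" and K: "K \<subseteq> J" "J \<inter> supported (label n -` {i}) \<subseteq> K"
  shows "\<exists>F. is_cover F \<and> (\<forall>f\<in>F. \<exists>b. local_basis f (supported (label n -` {i})) K {..<v i} b)"
proof -
  obtain F where F: "is_cover F"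
    and b: "\<forall>f\<in>F. \<exists>b. local_basis f UNIV J (SIGMA i:{0..n}. {..<v i}) b \<and>
         (\<forall>i\<le>n. \<forall>k<v i. \<forall>\<gamma>\<in>Gam n.
            is_zero_at f J (gam_act alg \<gamma> (b (i, k)) - scl (alg (rho i \<gamma>)) (b (i, k))))"
    using J unfolding Hilb_def by blast
  have "\<exists>b. local_basis f (supported (label n -` {i})) K {..<v i} b" if "f \<in> F" for f
    using b[rule_format, OF that]
    by (elim exE conjE) (rule exI, rule local_basis_isotypic[OF alg Hilb_homogeneous[OF alg J] i K], blast+)
  then show ?thesis using F by blast
qed

lemma hilb_to_quot_mem_Quot:
  fixes alg :: "complex \<Rightarrow> 'a::comm_ring_1"
  assumes alg: "is_ring_hom alg" and Ip: "Ip \<subseteq> {0..n}" and J: "J \<in> Hilb n v alg"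
  shows "hilb_to_quot n Ip alg J \<in> Quot n Ip v alg"
proof -
  have hom: "homogeneous n J" by (rule Hilb_homogeneous[OF alg J])
  have "module.subspace (*) J" using J by (simp add: Hilb_def)
  then have "stable_under_moves n Ip (J \<inter> supported (label n -` Ip))"
    using hom by (rule ideal_stable_under_moves)
  moreover have "\<exists>F. is_cover F \<and> (\<forall>f\<in>F. \<exists>b. local_basis f (supported (label n -` {i}))
      (J \<inter> supported (label n -` Ip)) {..<v i} b)" if "i \<in> Ip" for i
    using that Ip supported_mono[of "label n -` {i}" "label n -` Ip"]
    by (intro Hilb_local_basis_isotypic[OF alg J]) auto
  ultimately show ?thesis
    using Hilb_subspace[OF J]
    by (simp add: hilb_to_quot_eq[OF alg hom Ip] Quot_iff[OF alg Ip] plane.subspace_inter subspace_supported)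
qed

text \<open>
  The projection to \<open>supported S\<close> commutes with the change of coefficients and fixes the elements of
  \<open>supported S\<close>, so it turns a linear combination of elements of \<open>h(J)\<close> into one of elements of
  \<open>h(J \<inter> supported S)\<close>.
\<close>

lemma base_change_Int_supported:
  assumes h: "is_ring_hom h" and J: "\<And>p. p \<in> J \<Longrightarrow> restr S p \<in> J"
  shows "base_change h J \<inter> supported S = base_change h (J \<inter> supported S)"
proof (intro equalityI subsetI)
  fix p assume p: "p \<in> base_change h J \<inter> supported S"
  have "restr S p \<in> base_change h (J \<inter> supported S)"
    unfolding base_change_def
  proof (rule restr_mem_span)
    show "p \<in> plane.span (Poly_Mapping.map h ` J)" using p by (simp add: base_change_def)
    fix x assume "x \<in> Poly_Mapping.map h ` J"
    then show "restr S x \<in> plane.span (Poly_Mapping.map h ` (J \<inter> supported S))"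
      using J by (auto simp: map_ring_hom_restr[OF h, symmetric] intro!: plane.span_base)
  qed
  moreover have "restr S p = p" using p by (simp add: restr_eq_self)
  ultimately show "p \<in> base_change h (J \<inter> supported S)" by simp
next
  fix p assume p: "p \<in> base_change h (J \<inter> supported S)"
  have "Poly_Mapping.map h ` (J \<inter> supported S) \<subseteq> supported S"
    by (auto simp: supported_iff lookup_map_ring_hom[OF h] ring_hom_0[OF h])
  then have "base_change h (J \<inter> supported S) \<subseteq> supported S"
    unfolding base_change_def by (rule plane.span_minimal) (rule subspace_supported)
  moreover have "base_change h (J \<inter> supported S) \<subseteq> base_change h J"
    unfolding base_change_def by (intro plane.span_mono image_mono) simp
  ultimately show "p \<in> base_change h J \<inter> supported S" using p by blast
qed

lemma hilb_to_quot_base_change: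
  assumes alg: "is_ring_hom alg" and h: "is_ring_hom h" and Ip: "Ip \<subseteq> {0..n}"
    and J: "homogeneous n J"
  shows "hilb_to_quot n Ip (h \<circ> alg) (base_change h J) = base_change h (hilb_to_quot n Ip alg J)"
proof -
  have "homogeneous n (base_change h J)"
    unfolding homogeneous_def
  proof (intro conjI ballI allI)
    show "plane.subspace (base_change h J)" by (simp add: base_change_def)
    fix p i assume "p \<in> base_change h J"
    then show "restr (label n -` {i}) p \<in> base_change h J"
      unfolding base_change_def
      by (rule restr_mem_span[rotated])
        (use J in \<open>auto simp: map_ring_hom_restr[OF h, symmetric] homogeneous_def intro!: plane.span_base\<close>)
  qed
  moreover have "finite Ip" using Ip finite_subset by blast
  ultimately show ?thesis
    using base_change_Int_supported[OF h homogeneous_restr[OF J]]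
    by (simp add: hilb_to_quot_eq[OF alg J Ip] hilb_to_quot_eq[OF is_ring_hom_comp[OF h alg] _ Ip])
qed

section \<open>The torus action\<close>

definition torus_weight :: "'a::comm_ring_1 \<times> 'a \<Rightarrow> nat \<times> nat \<Rightarrow> 'a" where
  "torus_weight t = (\<lambda>(a, b). fst t ^ a * snd t ^ b)"

lemma torus_act_eq: "torus_act t = weight_act (torus_weight t)"
  by (cases t) (simp add: torus_act_eq_weight_act torus_weight_def)

lemma torus_weight_add: "torus_weight t (m + m') = torus_weight t m * torus_weight t m'"
  by (cases m; cases m') (simp add: torus_weight_def power_add algebra_simps)

lemma torus_inverse:
  assumes "t \<in> torus"
  obtains t' where "t' \<in> torus" "\<And>m. torus_weight t m * torus_weight t' m = 1"
proof -
  obtain s u where t: "t = (s, u)" and "s dvd 1" "u dvd 1"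
    using assms by (auto simp: torus_def)
  then obtain s' u' where inv: "s * s' = 1" "u * u' = 1" by (metis dvdE)
  have "torus_weight t m * torus_weight (s', u') m = (s * s') ^ fst m * (u * u') ^ snd m" for m
    by (simp add: t torus_weight_def case_prod_unfold power_mult_distrib algebra_simps)
  moreover have "s' dvd 1" "u' dvd 1"
    using inv dvd_triv_right[of s' s] dvd_triv_right[of u' u] by simp_all
  then have "(s', u') \<in> torus" by (simp add: torus_def)
  ultimately show ?thesis using that[of "(s', u')"] inv by simp
qed

text \<open>
  The inverse weight is a parameter, so that membership in the image of a submodule can be rewritten
  as membership in the submodule itself.
\<close>

locale invertible_weight =
  fixes w w' :: "nat \<times> nat \<Rightarrow> 'a::comm_ring_1"
  assumes inverse: "w m * w' m = 1"
begin

lemma act_inverse [simp]: "weight_act w (weight_act w' p) = p" "weight_act w' (weight_act w p) = p"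
proof -
  have "w' m * w m = 1" for m by (metis inverse mult.commute)
  then show "weight_act w (weight_act w' p) = p" "weight_act w' (weight_act w p) = p"
    by (simp_all add: poly_mapping_eqI inverse mult.assoc[symmetric])
qed

lemma mem_image_iff: "p \<in> weight_act w ` J \<longleftrightarrow> weight_act w' p \<in> J"
  by (metis act_inverse imageE imageI)

lemma image_Int_supported: "weight_act w ` (J \<inter> supported S) = weight_act w ` J \<inter> supported S"
proof -
  have "weight_act w' p \<in> supported S \<longleftrightarrow> p \<in> supported S" for p
    by (metis act_inverse weight_act_mem_supported)
  then show ?thesis by (intro set_eqI) (simp only: mem_image_iff Int_iff)
qed

lemma subspace_image: "plane.subspace J \<Longrightarrow> plane.subspace (weight_act w ` J)"
  unfolding plane.subspace_def Ball_def mem_image_iff weight_act_add weight_act_scl weight_act_0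
  by blast

lemma local_basis_image:
  assumes "local_basis f M J K b"
    and M: "\<And>p. p \<in> M \<Longrightarrow> weight_act w p \<in> M" "\<And>p. p \<in> M \<Longrightarrow> weight_act w' p \<in> M"
  shows "local_basis f M (weight_act w ` J) K (\<lambda>k. weight_act w (b k))"
  unfolding local_basis_def mem_image_iff weight_act_diff weight_act_sum weight_act_scl act_inverse
  using assms unfolding local_basis_def by blast

end

text \<open>
  Torus elements act by \<open>A\<close>-linear ring automorphisms commuting with the group; they transport ideals,
  local bases and eigenvectors.
\<close>

lemma torus_act_Hilb:
  fixes alg :: "complex \<Rightarrow> 'a::comm_ring_1"
  assumes alg: "is_ring_hom alg" and t: "t \<in> torus" and J: "J \<in> Hilb n v alg"
  shows "torus_act t ` J \<in> Hilb n v alg"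
proof -
  obtain t' where inv: "torus_weight t m * torus_weight t' m = 1" for m
    using torus_inverse[OF t] by blast
  let ?w = "torus_weight t" and ?w' = "torus_weight t'"
  interpret invertible_weight ?w ?w' by unfold_locales (rule inv)
  have mult: "weight_act ?w' (p * q) = weight_act ?w' p * weight_act ?w' q" for p q
    by (rule weight_act_times) (rule torus_weight_add)
  have gam: "gam_act alg \<gamma> (weight_act u p) = weight_act u (gam_act alg \<gamma> p)" for \<gamma> p u
    unfolding gam_act_def torus_act_eq by (rule weight_act_commute)
  have ideal: "module.subspace (*) J" using J by (simp add: Hilb_def)
  have "weight_act ?w' (c * p) \<in> J" if "weight_act ?w' p \<in> J" for c p
    using that ideal by (simp add: mult module.subspace_def[OF module_times])
  then have ideal_image: "module.subspace (*) (weight_act ?w ` J)"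
    using ideal
    unfolding module.subspace_def[OF module_times] Ball_def mem_image_iff weight_act_add weight_act_0
    by blast
  have gam_image: "gam_act alg \<gamma> ` weight_act ?w ` J \<subseteq> weight_act ?w ` J" if "\<gamma> \<in> Gam n" for \<gamma>
  proof -
    have "gam_act alg \<gamma> ` J \<subseteq> J" using J that unfolding Hilb_def by blast
    then show ?thesis by (auto simp: gam intro!: imageI)
  qed
  obtain F where F: "is_cover F"
    and b: "\<forall>f\<in>F. \<exists>b. local_basis f UNIV J (SIGMA i:{0..n}. {..<v i}) b \<and>
         (\<forall>i\<le>n. \<forall>k<v i. \<forall>\<gamma>\<in>Gam n.
            is_zero_at f J (gam_act alg \<gamma> (b (i, k)) - scl (alg (rho i \<gamma>)) (b (i, k))))"
    using J unfolding Hilb_def by blast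
  have "\<exists>b. local_basis f UNIV (weight_act ?w ` J) (SIGMA i:{0..n}. {..<v i}) b \<and>
         (\<forall>i\<le>n. \<forall>k<v i. \<forall>\<gamma>\<in>Gam n.
            is_zero_at f (weight_act ?w ` J) (gam_act alg \<gamma> (b (i, k)) - scl (alg (rho i \<gamma>)) (b (i, k))))"
    if "f \<in> F" for f
  proof -
    obtain b where "local_basis f UNIV J (SIGMA i:{0..n}. {..<v i}) b"
      and e: "\<forall>i\<le>n. \<forall>k<v i. \<forall>\<gamma>\<in>Gam n.
            is_zero_at f J (gam_act alg \<gamma> (b (i, k)) - scl (alg (rho i \<gamma>)) (b (i, k)))"
      using b \<open>f \<in> F\<close> by blast
    then have "local_basis f UNIV (weight_act ?w ` J) (SIGMA i:{0..n}. {..<v i}) (\<lambda>x. weight_act ?w (b x))"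
      by (intro local_basis_image) auto
    moreover have "is_zero_at f (weight_act ?w ` J) (weight_act ?w p)" if "is_zero_at f J p" for p
      using that by (simp add: is_zero_at_def mem_image_iff weight_act_scl)
    then have "\<forall>i\<le>n. \<forall>k<v i. \<forall>\<gamma>\<in>Gam n. is_zero_at f (weight_act ?w ` J)
        (gam_act alg \<gamma> (weight_act ?w (b (i, k))) - scl (alg (rho i \<gamma>)) (weight_act ?w (b (i, k))))"
      using e by (simp add: gam weight_act_scl[symmetric] weight_act_diff[symmetric])
    ultimately show ?thesis by blast
  qed
  then show ?thesis
    using ideal_image gam_image F unfolding torus_act_eq Hilb_def mem_Collect_eq by blast
qed

text \<open>
  The torus action takes a move to a multiple of itself, so a submodule stable under moves stays so.
\<close>

lemma torus_act_Quot:
  fixes alg :: "complex \<Rightarrow> 'a::comm_ring_1"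
  assumes alg: "is_ring_hom alg" and Ip: "Ip \<subseteq> {0..n}"
    and t: "t \<in> torus" and K: "K \<in> Quot n Ip v alg"
  shows "torus_act t ` K \<in> Quot n Ip v alg"
proof -
  obtain t' where inv: "torus_weight t m * torus_weight t' m = 1" for m
    using torus_inverse[OF t] by blast
  let ?w = "torus_weight t" and ?w' = "torus_weight t'"
  interpret invertible_weight ?w ?w' by unfold_locales (rule inv)
  have K': "K \<subseteq> supported (label n -` Ip)" "plane.subspace K" "stable_under_moves n Ip K"
    and b: "\<And>i. i \<in> Ip \<Longrightarrow> \<exists>F. is_cover F \<and>
      (\<forall>f\<in>F. \<exists>b. local_basis f (supported (label n -` {i})) K {..<v i} b)"
    using K by (simp_all add: Quot_iff[OF alg Ip])
  have "stable_under_moves n Ip (weight_act ?w ` K)"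
    unfolding stable_under_moves_def mem_image_iff
  proof (intro ballI allI impI)
    fix p d m assume p: "p \<in> weight_act ?w ` K" "label n m \<in> Ip" "label n (d + m) \<in> Ip"
    have "weight_act ?w' (mon d * restr (label n -` {label n m}) p) =
        scl (?w' d) (mon d * restr (label n -` {label n m}) (weight_act ?w' p))"
      by (simp add: weight_act_times[OF torus_weight_add] weight_act_mon restr_weight_act scl_times_left)
    moreover have "mon d * restr (label n -` {label n m}) (weight_act ?w' p) \<in> K"
      using p K'(3) unfolding mem_image_iff stable_under_moves_def by blast
    ultimately show "weight_act ?w' (mon d * restr (label n -` {label n m}) p) \<in> K"
      using K'(2) by (simp add: plane.subspace_scale)
  qed
  moreover have "weight_act ?w ` K \<subseteq> supported (label n -` Ip)"
    using K'(1) weight_act_mem_supported by blast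
  moreover have "\<exists>F. is_cover F \<and> (\<forall>f\<in>F. \<exists>b. local_basis f (supported (label n -` {i}))
      (weight_act ?w ` K) {..<v i} b)" if "i \<in> Ip" for i
    using b[OF that] local_basis_image weight_act_mem_supported by meson
  ultimately show ?thesis
    using subspace_image[OF K'(2)] by (simp add: Quot_iff[OF alg Ip] torus_act_eq)
qed

lemma hilb_to_quot_torus_act:
  fixes alg :: "complex \<Rightarrow> 'a::comm_ring_1"
  assumes alg: "is_ring_hom alg" and Ip: "Ip \<subseteq> {0..n}"
    and t: "t \<in> torus" and J: "J \<in> Hilb n v alg"
  shows "hilb_to_quot n Ip alg (torus_act t ` J) = torus_act t ` hilb_to_quot n Ip alg J"
proof -
  obtain t' where inv: "torus_weight t m * torus_weight t' m = 1" for m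
    using torus_inverse[OF t] by blast
  interpret invertible_weight "torus_weight t" "torus_weight t'" by unfold_locales (rule inv)
  show ?thesis
    using hilb_to_quot_eq[OF alg Hilb_homogeneous[OF alg J] Ip]
      hilb_to_quot_eq[OF alg Hilb_homogeneous[OF alg torus_act_Hilb[OF alg t J]] Ip]
    by (simp add: torus_act_eq image_Int_supported)
qed

lemma hilb_to_quot_fixed_points:
  assumes Ip: "Ip \<subseteq> {0..n}" and J: "J \<in> fixed_points (Hilb n v id)"
  shows "hilb_to_quot n Ip id J \<in> fixed_points (Quot n Ip v id)"
proof -
  have "J \<in> Hilb n v id" and fixed: "\<And>t. t \<in> torus \<Longrightarrow> torus_act t ` J = J"
    using J by (auto simp: fixed_points_def)
  then show ?thesis
    using hilb_to_quot_mem_Quot[OF is_ring_hom_id Ip] hilb_to_quot_torus_act[OF is_ring_hom_id Ip, of _ J v]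
    by (simp add: fixed_points_def)
qed

section \<open>Monomial submodules and their bases\<close>

text \<open>
  The inclusions determine which monomials of \<open>S\<close> lie in \<open>J\<close> and leave the rest of \<open>J\<close> free. This covers a
  monomial ideal with all monomials for \<open>S\<close> as well as a monomial kernel with those of one label.
\<close>

lemma local_basis_monomials:
  fixes J :: "'a::comm_ring_1 plane set"
  assumes e: "bij_betw e K (S \<inter> \<nu>)" and K: "finite K"
    and J: "supported (S - \<nu>) \<subseteq> J" "J \<subseteq> supported (- \<nu>)"
  shows "local_basis 1 (supported S) J K (\<lambda>k. mon (e k))"
  unfolding local_basis_def
proof (intro conjI ballI allI impI)
  show "mon (e k) \<in> supported S" if "k \<in> K" for k
    using e that by (auto simp: bij_betw_def)
  have fin: "finite (S \<inter> \<nu>)" using e K bij_betw_finite by blast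
  show "\<exists>N c. scl (1 ^ N) p - (\<Sum>k\<in>K. scl (c k) (mon (e k))) \<in> J" if p: "p \<in> supported S" for p
  proof (intro exI)
    have "(\<Sum>k\<in>K. scl (Poly_Mapping.lookup p (e k)) (mon (e k))) = restr (S \<inter> \<nu>) p"
      unfolding restr_eq_sum_mon[OF fin]
      using sum.reindex_bij_betw[OF e, of "\<lambda>m. scl (Poly_Mapping.lookup p m) (mon m)"] .
    then show "scl (1 ^ 0) p - (\<Sum>k\<in>K. scl (Poly_Mapping.lookup p (e k)) (mon (e k))) \<in> J"
      using J(1) minus_restr_mem_supported[OF p, of "S \<inter> \<nu>"] by (auto simp: Diff_Int)
  qed
  fix c k assume c: "(\<Sum>k\<in>K. scl (c k) (mon (e k))) \<in> J" and k: "k \<in> K"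
  have inj: "e j = e k \<longleftrightarrow> j = k" if "j \<in> K" for j
    using e k that by (auto simp: bij_betw_def inj_on_def)
  have "e k \<in> \<nu>" using e k by (auto simp: bij_betw_def)
  moreover have "(\<Sum>k\<in>K. scl (c k) (mon (e k))) \<in> supported (- \<nu>)" using J(2) c by blast
  ultimately have "Poly_Mapping.lookup (\<Sum>k\<in>K. scl (c k) (mon (e k))) (e k) = 0"
    unfolding supported_iff by blast
  also have "Poly_Mapping.lookup (\<Sum>k\<in>K. scl (c k) (mon (e k))) (e k) = (\<Sum>j\<in>K. if j = k then c j else 0)"
    unfolding lookup_sum by (intro sum.cong) (auto simp: lookup_mon inj)
  finally have "c k = 0" using K k by simp
  then show "\<exists>N. 1 ^ N * c k = 0" by simp
qed

text \<open>
  The projections of the \<open>b k\<close> to the span of the monomials in \<open>S \<inter> \<nu>\<close> form a second basis of this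
  space, because \<open>J\<close> contains the kernel of the projection on \<open>supported S\<close> and is itself projected to
  zero.
\<close>

lemma monomial_basis_card:
  fixes J :: "complex plane set"
  assumes J: "supported (S - \<nu>) \<subseteq> J" "J \<subseteq> supported (- \<nu>)" "plane.subspace J"
    and basis: "local_basis f (supported S) J K b" and "f \<noteq> 0" "finite K"
  shows "finite (S \<inter> \<nu>)" "card (S \<inter> \<nu>) = card K"
proof -
  interpret vs: vector_space "scl :: complex \<Rightarrow> _"
    by (rule module_iff_vector_space[THEN iffD1]) (rule module_scl)
  define B where "B = S \<inter> \<nu>"
  define b' where "b' k = restr B (b k)" for k
  have bS: "b k \<in> supported S" if "k \<in> K" for k
    using basis that by (simp add: local_basis_def)
  have b'_indep: "c k = 0" if c: "(\<Sum>k\<in>K. scl (c k) (b' k)) = 0" and k: "k \<in> K" for c k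
  proof -
    let ?q = "\<Sum>k\<in>K. scl (c k) (b k)"
    have "?q \<in> supported S"
      using bS by (intro plane.subspace_sum plane.subspace_scale subspace_supported)
    moreover have "restr B ?q = 0" using c by (simp add: restr_sum restr_scl b'_def)
    ultimately have "?q \<in> J"
      using minus_restr_mem_supported[of ?q S B] J(1) by (auto simp: B_def Diff_Int)
    then obtain N where "f ^ N * c k = 0" using basis k unfolding local_basis_def by blast
    then show ?thesis using \<open>f \<noteq> 0\<close> by simp
  qed
  have inj: "inj_on b' K"
  proof (rule inj_onI, rule ccontr)
    fix j k assume jk: "j \<in> K" "k \<in> K" "b' j = b' k" "j \<noteq> k"
    \<comment> \<open>The coefficients of the relation \<open>b' j - b' k = 0\<close>.\<close>
    define c where "c l = (if l = j then 1 else if l = k then - 1 else 0 :: complex)" for l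
    have "(\<Sum>l\<in>K. scl (c l) (b' l)) = (\<Sum>l\<in>K. (if l = j then b' j else 0) - (if l = k then b' k else 0))"
      by (intro sum.cong) (use jk in \<open>auto simp: c_def plane.scale_minus_left\<close>)
    also have "\<dots> = 0" using jk \<open>finite K\<close> by (simp add: sum_subtractf)
    finally show False using b'_indep[of c j] jk by (simp add: c_def)
  qed
  have indep: "plane.independent (b' ` K)"
  proof (rule vs.independent_if_scalars_zero)
    fix c x assume "(\<Sum>x\<in>b' ` K. scl (c x) x) = 0" "x \<in> b' ` K"
    then show "c x = 0" using b'_indep[of "\<lambda>k. c (b' k)"] by (auto simp: sum.reindex[OF inj])
  qed (use \<open>finite K\<close> in simp)
  have "supported B \<subseteq> plane.span (b' ` K)"
  proof
    fix p assume p: "p \<in> (supported B :: complex plane set)"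
    then have "p \<in> supported S" using supported_mono[of B S] by (auto simp: B_def)
    then obtain N c where "scl (f ^ N) p - (\<Sum>k\<in>K. scl (c k) (b k)) \<in> J"
      using basis unfolding local_basis_def by blast
    then have "restr B (scl (f ^ N) p - (\<Sum>k\<in>K. scl (c k) (b k))) = 0"
      using J(2) by (intro restr_eq_0[of _ "- \<nu>"]) (auto simp: B_def)
    then have "scl (f ^ N) p = (\<Sum>k\<in>K. scl (c k) (b' k))"
      using p by (simp add: restr_diff restr_sum restr_scl b'_def restr_eq_self[THEN iffD2])
    then have "scl (f ^ N) p \<in> plane.span (b' ` K)"
      by (simp only:) (intro plane.span_sum plane.span_scale plane.span_base imageI)
    then have "scl (inverse (f ^ N)) (scl (f ^ N) p) \<in> plane.span (b' ` K)"
      by (rule plane.span_scale)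
    then show "p \<in> plane.span (b' ` K)" using \<open>f \<noteq> 0\<close> by simp
  qed
  then have span: "mon ` B \<subseteq> plane.span (b' ` K)"
    by auto
  have span': "b' ` K \<subseteq> plane.span (mon ` B)"
    unfolding span_mon by (auto simp: b'_def)
  have mon_indep: "plane.independent (mon ` B :: complex plane set)"
    unfolding vs.independent_explicit_finite_subsets
  proof (intro allI impI ballI)
    fix A u x assume A: "A \<subseteq> mon ` B" "finite A" and 0: "(\<Sum>x\<in>A. scl (u x) x) = 0" and x: "x \<in> A"
    obtain m where m: "x = mon m" using A x by auto
    have "0 = Poly_Mapping.lookup (\<Sum>x\<in>A. scl (u x) x) m" using 0 by simp
    also have "\<dots> = (\<Sum>y\<in>A. if y = x then u y else 0)"
      unfolding lookup_sum
    proof (intro sum.cong refl)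
      fix y assume "y \<in> A"
      then obtain k where "y = mon k" using A by auto
      then show "Poly_Mapping.lookup (scl (u y) y) m = (if y = x then u y else 0)"
        by (simp add: m lookup_mon inj_eq[OF inj_mon])
    qed
    finally show "u x = 0" using A x by simp
  qed
  have inj_B: "inj_on (mon :: _ \<Rightarrow> complex plane) B" using inj_mon inj_on_subset by blast
  have 1: "finite (mon ` B :: complex plane set) \<and> card (mon ` B :: complex plane set) \<le> card (b' ` K)"
    using vs.independent_span_bound[OF _ mon_indep span] \<open>finite K\<close> by simp
  then have 2: "card (b' ` K) \<le> card (mon ` B :: complex plane set)"
    using vs.independent_span_bound[OF _ indep span'] by simp
  show "finite (S \<inter> \<nu>)" using 1 finite_imageD[OF _ inj_B] by (simp add: B_def)
  show "card (S \<inter> \<nu>) = card K"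
    using 1 2 by (simp add: card_image[OF inj] card_image[OF inj_B] B_def[symmetric])
qed

lemma is_cover_1: "is_cover {1}"
proof -
  have "a \<in> module.span (*) {1}" for a :: 'a
    unfolding module.span_singleton[OF module_times] by auto
  then show ?thesis by (auto simp: is_cover_def)
qed

lemma is_cover_nonzero:
  assumes "is_cover F"
  shows "\<exists>f\<in>F. f \<noteq> (0 :: 'a::comm_ring_1)"
proof (rule ccontr)
  assume "\<not> ?thesis"
  then have "module.span (*) F \<subseteq> {0}"
    by (intro module.span_minimal[OF module_times] module.subspace_single_0[OF module_times]) auto
  then have "(1 :: 'a) \<in> {0}" using assms unfolding is_cover_def by blast
  then show False by simp
qed

lemma torus_act_supported:
  assumes "t \<in> torus"
  shows "torus_act t ` supported S = supported S"
proof -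
  obtain t' where inv: "torus_weight t m * torus_weight t' m = 1" for m
    using torus_inverse[OF assms] by blast
  interpret invertible_weight "torus_weight t" "torus_weight t'" by unfold_locales (rule inv)
  have "surj (weight_act (torus_weight t))" by (metis act_inverse(1) surjI)
  then show ?thesis
    using image_Int_supported[of UNIV S] by (simp add: torus_act_eq)
qed

text \<open>
  The torus elements \<open>(2, 1)\<close> and \<open>(1, 2)\<close> separate the exponents of \<open>x\<close> and of \<open>y\<close>. Projecting to
  weight components for one and then the other extracts any monomial that occurs in an element of
  \<open>J\<close>.
\<close>

lemma torus_fixed_eq_supported:
  fixes J :: "complex plane set"
  assumes J: "plane.subspace J" and fixed: "\<And>t. t \<in> torus \<Longrightarrow> torus_act t ` J = J"
  shows "J = supported {m. mon m \<in> J}"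
proof
  show "supported {m. mon m \<in> J} \<subseteq> J"
    using supported_subset_iff[OF J] by blast
  have two: "(2 :: complex) ^ a = 2 ^ b \<longleftrightarrow> a = b" for a b
    by (metis norm_numeral norm_power one_less_numeral_iff power_inject_exp semiring_norm(76))
  have component: "restr {m. torus_weight t m = torus_weight t m\<^sub>0} p \<in> J"
    if "t \<in> torus" "p \<in> J" for t :: "complex \<times> complex" and m\<^sub>0 p
  proof (rule weight_component_mem[where w = "torus_weight t"])
    show "weight_act (torus_weight t) q \<in> J" if "q \<in> J" for q
      using fixed[OF \<open>t \<in> torus\<close>] that by (auto simp: torus_act_eq)
  qed (use J that in \<open>simp_all add: dvd_field_iff\<close>)
  have tori: "(2, 1) \<in> (torus :: (complex \<times> complex) set)" "(1, 2) \<in> (torus :: (complex \<times> complex) set)"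
    by (auto simp: torus_def dvd_field_iff)
  show "J \<subseteq> supported {m. mon m \<in> J}"
  proof
    fix p assume p: "p \<in> J"
    have "mon m \<in> J" if m: "m \<in> Poly_Mapping.keys p" for m
    proof -
      have "restr {k. snd k = snd m} (restr {k. fst k = fst m} p) \<in> J"
        using component[OF tori(2), of _ m] component[OF tori(1) p, of m]
        by (simp add: torus_weight_def case_prod_unfold two)
      moreover have "restr {k. snd k = snd m} (restr {k. fst k = fst m} p) = scl (Poly_Mapping.lookup p m) (mon m)"
        by (rule poly_mapping_eqI) (auto simp: lookup_mon prod_eq_iff)
      ultimately have "scl (inverse (Poly_Mapping.lookup p m)) (scl (Poly_Mapping.lookup p m) (mon m)) \<in> J"
        using J by (simp add: plane.subspace_scale del: plane.scale_scale)
      then show ?thesis using m by (simp add: in_keys_iff)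
    qed
    then show "p \<in> supported {m. mon m \<in> J}" by (auto simp: supported_def)
  qed
qed

section \<open>Fixed points of the Hilbert scheme\<close>

lemma monomial_ideal_eq_supported: "monomial_ideal \<nu> = supported (- \<nu>)"
  by (simp add: monomial_ideal_def span_mon Compl_eq)

lemma monomial_kernel_eq_supported: "monomial_kernel n Ip \<nu> = supported (label n -` Ip - \<nu>)"
proof -
  have "{m. m \<notin> \<nu> \<and> label n m \<in> Ip} = label n -` Ip - \<nu>" by auto
  then show ?thesis by (simp add: monomial_kernel_def span_mon)
qed

lemma partition_mem_le:
  "\<nu> \<in> partitions \<Longrightarrow> (a, b) \<in> \<nu> \<Longrightarrow> a' \<le> a \<Longrightarrow> b' \<le> b \<Longrightarrow> (a', b') \<in> \<nu>"
  unfolding partitions_def by blast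

lemma partition_mem_add: "\<nu> \<in> partitions \<Longrightarrow> d + m \<in> \<nu> \<Longrightarrow> m \<in> \<nu>"
  by (cases d; cases m) (auto intro: partition_mem_le)

lemma ideal_supported:
  assumes "\<And>d m. m \<in> S \<Longrightarrow> d + m \<in> S"
  shows "module.subspace (*) (supported S)"
proof -
  have "c * p \<in> supported S" if "p \<in> supported S" for c p :: "'a plane"
    using that keys_mult[of c p] assms unfolding supported_def by blast
  then show ?thesis
    using subspace_supported[of S] unfolding module.subspace_def[OF module_times] plane.subspace_def by blast
qed

lemma ideal_monomial_ideal: "\<nu> \<in> partitions \<Longrightarrow> module.subspace (*) (supported (- \<nu>))"
  by (rule ideal_supported) (auto dest: partition_mem_add)

lemma homogeneous_supported: "homogeneous n (supported S)"
  unfolding homogeneous_def using subspace_supported by (auto simp: supported_iff)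

lemma finite_cells_bij:
  assumes "finite \<nu>"
  shows "\<exists>e. bij_betw e {..<wt n i \<nu>} (label n -` {i} \<inter> \<nu>)"
proof -
  have "{c \<in> \<nu>. label n c = i} = label n -` {i} \<inter> \<nu>" by auto
  then show ?thesis
    using ex_bij_betw_nat_finite[of "label n -` {i} \<inter> \<nu>"] assms
    by (simp add: wt_def atLeast0LessThan)
qed

lemma monomial_ideal_mem_Hilb:
  assumes alg: "is_ring_hom alg" and \<nu>: "\<nu> \<in> partitions" and wt: "\<forall>i\<in>{0..n}. wt n i \<nu> = v i"
  shows "supported (- \<nu>) \<in> Hilb n v alg"
proof -
  have "finite \<nu>" using \<nu> by (simp add: partitions_def)
  then obtain e where e: "bij_betw (e i) {..<wt n i \<nu>} (label n -` {i} \<inter> \<nu>)" for i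
    using finite_cells_bij by metis
  define e' where "e' = (\<lambda>(i, k). e i k)"
  have label: "label n (e' (i, k)) = i" if "i \<le> n" "k < v i" for i k
    using bij_betwE[OF e[of i]] wt that by (auto simp: e'_def)
  let ?S = "SIGMA i:{0..n}. {..<v i}"
  have "e' ` ?S = (\<Union>i\<in>{0..n}. e i ` {..<wt n i \<nu>})"
  proof (intro equalityI subsetI)
    fix c assume "c \<in> (\<Union>i\<in>{0..n}. e i ` {..<wt n i \<nu>})"
    then obtain i k where "c = e' (i, k)" "(i, k) \<in> ?S" using wt by (auto simp: e'_def)
    then show "c \<in> e' ` ?S" by blast
  qed (use wt in \<open>auto simp: e'_def\<close>)
  also have "\<dots> = \<nu>" using e label_le by (auto simp: bij_betw_def)
  finally have "e' ` ?S = \<nu>" .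
  moreover have "inj_on e' ?S"
  proof (rule inj_onI)
    fix x y assume x: "x \<in> ?S" and y: "y \<in> ?S" and eq: "e' x = e' y"
    obtain i k j l where xy: "x = (i, k)" "y = (j, l)" by fastforce
    have "i = j" using label[of i k] label[of j l] x y eq xy by simp
    moreover have "inj_on (e i) {..<v i}" using e[of i] wt x xy by (simp add: bij_betw_def)
    ultimately show "x = y" using x y eq by (auto simp: xy e'_def inj_on_def)
  qed
  ultimately have bij: "bij_betw e' ?S (UNIV \<inter> \<nu>)" by (simp add: bij_betw_def)
  have UNIV: "supported UNIV = (UNIV :: 'a plane set)" by (auto simp: supported_def)
  have "local_basis 1 UNIV (supported (- \<nu>) :: 'a plane set) ?S (\<lambda>x. mon (e' x))"
    unfolding UNIV[symmetric] by (rule local_basis_monomials[OF bij]) (auto simp: Compl_eq_Diff_UNIV)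
  moreover have "is_zero_at 1 (supported (- \<nu>)) (gam_act alg \<gamma> (mon (e' (i, k))) - scl (alg (rho i \<gamma>)) (mon (e' (i, k))))"
    if "i \<le> n" "k < v i" "\<gamma> \<in> Gam n" for i k \<gamma>
    using label[OF that(1,2)] plane.subspace_0[OF subspace_supported]
    by (simp add: gam_act_eq_weight_act[OF alg that(3)] weight_act_mon is_zero_at_def)
  moreover have "gam_act alg \<gamma> ` supported (- \<nu>) \<subseteq> supported (- \<nu>)" if "\<gamma> \<in> Gam n" for \<gamma>
    using weight_act_mem_supported by (auto simp: gam_act_eq_weight_act[OF alg that])
  ultimately show ?thesis
    using ideal_monomial_ideal[OF \<nu>] is_cover_1 unfolding Hilb_def mem_Collect_eq by blast
qed

text \<open>
  For surjectivity, a fixed ideal \<open>J\<close> is spanned by monomials, and \<open>\<nu>\<close> consists of the remaining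
  exponents. The rank conditions count the cells of \<open>\<nu>\<close> label by label; in particular they show that \<open>\<nu>\<close> is
  finite.
\<close>

lemma bij_betw_monomial_ideal:
  "bij_betw monomial_ideal {\<nu> \<in> partitions. \<forall>i\<in>{0..n}. wt n i \<nu> = v i} (fixed_points (Hilb n v id))"
  unfolding bij_betw_def
proof (intro conjI equalityI subsetI)
  show "inj_on monomial_ideal {\<nu> \<in> partitions. \<forall>i\<in>{0..n}. wt n i \<nu> = v i}"
    by (rule inj_onI) (simp add: monomial_ideal_eq_supported supported_inject)
next
  fix J assume "J \<in> monomial_ideal ` {\<nu> \<in> partitions. \<forall>i\<in>{0..n}. wt n i \<nu> = v i}"
  then obtain \<nu> where "J = supported (- \<nu>)" "\<nu> \<in> partitions" "\<forall>i\<in>{0..n}. wt n i \<nu> = v i"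
    by (auto simp: monomial_ideal_eq_supported)
  then show "J \<in> fixed_points (Hilb n v id)"
    unfolding fixed_points_def
    using monomial_ideal_mem_Hilb[OF is_ring_hom_id] torus_act_supported by blast
next
  fix J assume J: "J \<in> fixed_points (Hilb n v id)"
  then have Hilb: "J \<in> Hilb n v id" by (simp add: fixed_points_def)
  define \<nu> where "\<nu> = {m. mon m \<notin> J}"
  have sub: "plane.subspace J" by (rule Hilb_subspace[OF Hilb])
  have "J = supported {m. mon m \<in> J}"
    using J by (intro torus_fixed_eq_supported sub) (simp add: fixed_points_def)
  also have "{m. mon m \<in> J} = - \<nu>" by (auto simp: \<nu>_def)
  finally have J_eq: "J = supported (- \<nu>)" .
  have cells: "finite (label n -` {i} \<inter> \<nu>) \<and> card (label n -` {i} \<inter> \<nu>) = v i" if i: "i \<in> {0..n}" for i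
  proof -
    obtain F where "is_cover F" and b: "\<And>f. f \<in> F \<Longrightarrow> \<exists>b. local_basis f (supported (label n -` {i})) J {..<v i} b"
      using Hilb_local_basis_isotypic[OF is_ring_hom_id Hilb i, of J] by blast
    then obtain f b where "f \<noteq> 0" "local_basis f (supported (label n -` {i})) J {..<v i} b"
      using is_cover_nonzero by blast
    moreover have "supported (label n -` {i} - \<nu>) \<subseteq> J"
      unfolding J_eq by (rule supported_mono) auto
    ultimately show ?thesis
      using monomial_basis_card[of "label n -` {i}" \<nu> J f "{..<v i}" b] sub J_eq by simp
  qed
  have "finite (\<Union>i\<in>{0..n}. label n -` {i} \<inter> \<nu>)" using cells by blast
  moreover have "\<nu> \<subseteq> (\<Union>i\<in>{0..n}. label n -` {i} \<inter> \<nu>)" using label_le by auto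
  ultimately have fin: "finite \<nu>" by (rule finite_subset[rotated])
  have "(a', b') \<in> \<nu>" if "(a, b) \<in> \<nu>" "a' \<le> a" "b' \<le> b" for a b a' b'
  proof (rule ccontr)
    assume "(a', b') \<notin> \<nu>"
    then have "mon (a - a', b - b') * mon (a', b') \<in> J"
      using Hilb by (simp add: \<nu>_def Hilb_def module.subspace_def[OF module_times])
    then show False using that by (simp add: mon_times_mon \<nu>_def)
  qed
  then have "\<nu> \<in> partitions" using fin unfolding partitions_def by blast
  moreover have "wt n i \<nu> = v i" if "i \<in> {0..n}" for i
  proof -
    have "{c \<in> \<nu>. label n c = i} = label n -` {i} \<inter> \<nu>" by auto
    then show ?thesis using cells[OF that] by (simp add: wt_def)
  qed
  ultimately show "J \<in> monomial_ideal ` {\<nu> \<in> partitions. \<forall>i\<in>{0..n}. wt n i \<nu> = v i}"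
    by (intro image_eqI[of _ _ \<nu>]) (simp_all add: monomial_ideal_eq_supported J_eq)
qed

section \<open>Partitions generated by a set of labels\<close>

text \<open>
  The addable cells of a partition are the minimal elements of its complement, and below every
  element of the complement there is a minimal one.
\<close>

lemma generated_partitions_iff:
  assumes \<nu>: "\<nu> \<in> partitions"
  shows "\<nu> \<in> generated_partitions n Ip \<longleftrightarrow>
    (\<forall>k. k \<notin> \<nu> \<longrightarrow> (\<exists>d m. m \<notin> \<nu> \<and> label n m \<in> Ip \<and> k = d + m))" (is "_ \<longleftrightarrow> ?R")
proof
  assume gen: "\<nu> \<in> generated_partitions n Ip"
  show ?R
  proof (intro allI impI)
    fix k assume "k \<notin> \<nu>"
    then show "\<exists>d m. m \<notin> \<nu> \<and> label n m \<in> Ip \<and> k = d + m"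
    proof (induct "fst k + snd k" arbitrary: k rule: less_induct)
      case less
      show ?case
      proof (cases "k \<in> addable \<nu>")
        case True
        then have "label n k \<in> Ip" using gen by (simp add: generated_partitions_def)
        then show ?thesis using less.prems by (intro exI[of _ 0] exI[of _ k]) simp
      next
        case False
        obtain p q where k: "k = (p, q)" by fastforce
        have fin: "finite (insert k \<nu>)" using \<nu> by (simp add: partitions_def)
        have "insert k \<nu> \<notin> partitions" using False less.prems by (simp add: addable_def)
        then obtain a b a' b' where ab: "(a, b) \<in> insert k \<nu>" "a' \<le> a" "b' \<le> b" "(a', b') \<notin> insert k \<nu>"
          using fin unfolding partitions_def by blast
        then have "(a, b) = k" using partition_mem_le[OF \<nu>] by blast
        then have le: "a' \<le> p" "b' \<le> q" "(a', b') \<noteq> (p, q)" using ab k by auto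
        then have "a' + b' < p + q" by (metis add_le_less_mono add_less_le_mono le_neq_implies_less)
        then obtain d m where "m \<notin> \<nu>" "label n m \<in> Ip" "(a', b') = d + m"
          using less.hyps[of "(a', b')"] ab(4) k by auto
        moreover have "k = (p - a', q - b') + (a', b')" using le k by simp
        ultimately show ?thesis by (metis add.assoc)
      qed
    qed
  qed
next
  assume R: ?R
  have "label n c \<in> Ip" if c: "c \<in> addable \<nu>" for c
  proof -
    obtain d m where m: "m \<notin> \<nu>" "label n m \<in> Ip" "c = d + m"
      using R c unfolding addable_def by blast
    then have "m \<in> insert c \<nu>"
      using c partition_mem_add[of "insert c \<nu>" d m] by (simp add: addable_def)
    then show ?thesis using m by auto
  qed
  then show "\<nu> \<in> generated_partitions n Ip" using \<nu> by (simp add: generated_partitions_def)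
qed

text \<open>
  The exponents of the monomials in the ideal generated by those with exponent in \<open>S\<close>.
\<close>

definition up_closure :: "(nat \<times> nat) set \<Rightarrow> (nat \<times> nat) set" where
  "up_closure S = {d + m | d m. m \<in> S}"

text \<open>
  The ideal generated by a set of monomials with labels in \<open>I\<^sup>+\<close> that is closed under moves has no
  further monomials with such labels. Thus a kernel can be recovered from the partition attached to
  it.
\<close>

lemma up_closure_inter_labels:
  assumes "S \<subseteq> label n -` Ip" "\<And>d m. m \<in> S \<Longrightarrow> label n (d + m) \<in> Ip \<Longrightarrow> d + m \<in> S"
    and "label n m \<in> Ip"
  shows "m \<in> up_closure S \<longleftrightarrow> m \<in> S"
proof
  assume "m \<in> S"
  then have "0 + m \<in> up_closure S" unfolding up_closure_def by blast
  then show "m \<in> up_closure S" by simp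
qed (use assms in \<open>auto simp: up_closure_def\<close>)

text \<open>
  All but finitely many monomials of label \<open>i\<close> lie in \<open>S\<close>, so \<open>S\<close> contains a power of \<open>x\<close> and a power
  of \<open>y\<close>, which bound the complement of the closure by a rectangle.
\<close>

lemma compl_up_closure_generated:
  assumes Ip: "Ip \<subseteq> {0..n}" and i: "i \<in> Ip" and S: "S \<subseteq> label n -` Ip"
    and closed: "\<And>d m. m \<in> S \<Longrightarrow> label n (d + m) \<in> Ip \<Longrightarrow> d + m \<in> S"
    and fin: "finite (label n -` {i} - S)"
  shows "- up_closure S \<in> generated_partitions n Ip"
proof -
  \<comment> \<open>A ray of exponents of label \<open>i\<close> is infinite, so it cannot avoid \<open>S\<close>.\<close>
  have ray: "\<exists>k. f k \<in> S" if "inj f" "\<And>k. label n (f k) = i" for f :: "nat \<Rightarrow> nat \<times> nat"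
  proof (rule ccontr)
    assume "\<not> ?thesis"
    then have "range f \<subseteq> label n -` {i} - S" using that by auto
    then have "finite (range f)" using fin finite_subset by blast
    then show False using finite_imageD[OF _ \<open>inj f\<close>] infinite_UNIV_nat by blast
  qed
  have i_le: "i \<le> n" using i Ip by auto
  have "\<exists>k. (i + k * (n + 1), 0) \<in> S"
  proof (rule ray)
    have "label n (i + k * (n + 1), 0) = label n (i, 0)" for k
    proof -
      have "int (i + k * (n + 1)) - int 0 - (int i - int 0) = (int n + 1) * int k"
        by (simp add: algebra_simps)
      then show ?thesis
        unfolding label_eq_iff mod_eq_dvd_iff by (metis dvd_triv_left)
    qed
    then show "label n (i + k * (n + 1), 0) = i" for k
      using label_column[OF i_le] by simp
  qed (simp add: inj_def del: mult_Suc_right)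
  then obtain a where a: "(a, 0) \<in> S" by blast
  have "\<exists>k. (0, n + 1 - i + k * (n + 1)) \<in> S"
  proof (rule ray)
    have "label n (0, n + 1 - i + k * (n + 1)) = label n (i, 0)" for k
    proof -
      have "int 0 - int (n + 1 - i + k * (n + 1)) - (int i - int 0) = (int n + 1) * (- 1 - int k)"
        using i_le by (simp add: of_nat_diff algebra_simps)
      then show ?thesis
        unfolding label_eq_iff mod_eq_dvd_iff by (metis dvd_triv_left)
    qed
    then show "label n (0, n + 1 - i + k * (n + 1)) = i" for k
      using label_column[OF i_le] by simp
  qed (simp add: inj_def del: mult_Suc_right)
  then obtain b where b: "(0, b) \<in> S" by blast
  have bound: "p < a \<and> q < b" if "(p, q) \<notin> up_closure S" for p q
  proof (rule ccontr)
    assume "\<not> (p < a \<and> q < b)"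
    then have "(p, q) = (p - a, q) + (a, 0) \<or> (p, q) = (p, q - b) + (0, b)" by auto
    then show False using that a b unfolding up_closure_def by blast
  qed
  have "- up_closure S \<subseteq> {..<a} \<times> {..<b}"
    using bound by auto
  then have "finite (- up_closure S)" by (rule finite_subset) simp
  moreover have "(p', q') \<notin> up_closure S" if "(p, q) \<notin> up_closure S" "p' \<le> p" "q' \<le> q" for p q p' q'
  proof
    assume "(p', q') \<in> up_closure S"
    then obtain d m where "(p', q') = d + m" "m \<in> S" unfolding up_closure_def by blast
    moreover have "(p, q) = (p - p', q - q') + (p', q')" using that by simp
    ultimately have "(p, q) = ((p - p', q - q') + d) + m" by (metis add.assoc)
    then show False using that \<open>m \<in> S\<close> unfolding up_closure_def by blast
  qed
  ultimately have part: "- up_closure S \<in> partitions" unfolding partitions_def by blast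
  have "\<exists>d m. m \<notin> - up_closure S \<and> label n m \<in> Ip \<and> k = d + m" if k: "k \<notin> - up_closure S" for k
  proof -
    obtain d m where dm: "m \<in> S" "k = d + m" using k unfolding up_closure_def by blast
    then show ?thesis using up_closure_inter_labels[OF S closed, of m] S by blast
  qed
  then show ?thesis using generated_partitions_iff[OF part] by blast
qed

text \<open>
  If \<open>\<mu>\<close> is generated and contains \<open>\<nu>\<close>, then the complement of \<open>\<mu>\<close> is the closure of some exponents outside
  \<open>\<nu>\<close> with labels in \<open>I\<^sup>+\<close>, hence contained in the closure of all of these; this makes the complement of
  the latter the least choice. It has the same cells with labels in \<open>I\<^sup>+\<close> as \<open>\<nu>\<close>, since the complement of \<open>\<nu>\<close>
  is already closed upwards.
\<close>

lemma
  assumes Ip: "Ip \<noteq> {}" "Ip \<subseteq> {0..n}" and \<nu>: "\<nu> \<in> partitions"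
  shows pi_gen_eq: "pi_gen n Ip \<nu> = - up_closure (label n -` Ip - \<nu>)"
    and pi_gen_generated: "pi_gen n Ip \<nu> \<in> generated_partitions n Ip"
    and mem_pi_gen_iff: "label n m \<in> Ip \<Longrightarrow> m \<in> pi_gen n Ip \<nu> \<longleftrightarrow> m \<in> \<nu>"
proof -
  let ?S = "label n -` Ip - \<nu>"
  obtain i where i: "i \<in> Ip" using Ip(1) by blast
  have closed: "d + m \<in> ?S" if "m \<in> ?S" "label n (d + m) \<in> Ip" for d m
    using that partition_mem_add[OF \<nu>, of d m] by auto
  have "label n -` {i} - ?S \<subseteq> \<nu>" using i by auto
  then have fin: "finite (label n -` {i} - ?S)"
    using \<nu> finite_subset by (auto simp: partitions_def)
  have gen: "- up_closure ?S \<in> generated_partitions n Ip"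
    by (rule compl_up_closure_generated[OF Ip(2) i _ closed fin]) auto
  show eq: "pi_gen n Ip \<nu> = - up_closure ?S"
    unfolding pi_gen_def
  proof (rule Least_equality)
    have "k \<notin> up_closure ?S" if "k \<in> \<nu>" for k
      using that partition_mem_add[OF \<nu>] unfolding up_closure_def by blast
    then show "- up_closure ?S \<in> generated_partitions n Ip \<and> \<nu> \<subseteq> - up_closure ?S"
      using gen by blast
    fix \<mu> assume \<mu>: "\<mu> \<in> generated_partitions n Ip \<and> \<nu> \<subseteq> \<mu>"
    then have part: "\<mu> \<in> partitions" by (simp add: generated_partitions_def)
    show "- up_closure ?S \<subseteq> \<mu>"
    proof (rule subsetI, rule ccontr)
      fix k assume k: "k \<in> - up_closure ?S" "k \<notin> \<mu>"
      then obtain d m where "m \<notin> \<mu>" "label n m \<in> Ip" "k = d + m"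
        using \<mu> generated_partitions_iff[OF part] by blast
      then have "k \<in> up_closure ?S" using \<mu> unfolding up_closure_def by blast
      then show False using k by simp
    qed
  qed
  then show "pi_gen n Ip \<nu> \<in> generated_partitions n Ip" using gen by simp
  show "m \<in> pi_gen n Ip \<nu> \<longleftrightarrow> m \<in> \<nu>" if "label n m \<in> Ip"
    using up_closure_inter_labels[OF _ closed that] that by (auto simp: eq)
qed

section \<open>Fixed points of the Quot scheme\<close>

lemma monomial_kernel_mem_Quot:
  assumes alg: "is_ring_hom alg" and Ip: "Ip \<subseteq> {0..n}"
    and \<nu>: "\<nu> \<in> partitions" and wt: "\<forall>i\<in>Ip. wt n i \<nu> = v i"
  shows "supported (label n -` Ip - \<nu>) \<in> Quot n Ip v alg"
proof -
  have eq: "supported (label n -` Ip - \<nu>) = supported (- \<nu>) \<inter> supported (label n -` Ip)"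
    unfolding supported_Int by (rule arg_cong[of _ _ supported]) auto
  have "stable_under_moves n Ip (supported (label n -` Ip - \<nu>))"
    unfolding eq by (intro ideal_stable_under_moves ideal_monomial_ideal[OF \<nu>] homogeneous_supported)
  moreover have "\<exists>F. is_cover F \<and> (\<forall>f\<in>F. \<exists>b. local_basis f (supported (label n -` {i}))
      (supported (label n -` Ip - \<nu>)) {..<v i} b)" if i: "i \<in> Ip" for i
  proof -
    have "finite \<nu>" using \<nu> by (simp add: partitions_def)
    then obtain e where "bij_betw e {..<v i} (label n -` {i} \<inter> \<nu>)"
      using finite_cells_bij[of \<nu> n i] wt i by auto
    then have "local_basis 1 (supported (label n -` {i})) (supported (label n -` Ip - \<nu>)) {..<v i} (\<lambda>k. mon (e k))"
      using i by (intro local_basis_monomials supported_mono) auto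
    then show ?thesis using is_cover_1 by blast
  qed
  moreover have "supported (label n -` Ip - \<nu>) \<subseteq> supported (label n -` Ip)"
    by (rule supported_mono) auto
  ultimately show ?thesis
    unfolding Quot_iff[OF alg Ip] using subspace_supported by blast
qed

text \<open>
  A generated partition is determined by the exponents outside it with labels in \<open>I\<^sup>+\<close>, which gives
  injectivity. A fixed kernel is spanned by monomials, and the partition mapped to it is the
  complement of the closure of their exponents.
\<close>

lemma bij_betw_monomial_kernel:
  assumes Ip: "Ip \<noteq> {}" "Ip \<subseteq> {0..n}"
  shows "bij_betw (monomial_kernel n Ip) {\<nu> \<in> generated_partitions n Ip. \<forall>i\<in>Ip. wt n i \<nu> = v i}
    (fixed_points (Quot n Ip v id))"
  unfolding bij_betw_def
proof (intro conjI equalityI subsetI)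
  let ?P = "{\<nu> \<in> generated_partitions n Ip. \<forall>i\<in>Ip. wt n i \<nu> = v i}"
  show "inj_on (monomial_kernel n Ip) ?P"
  proof (rule inj_onI)
    fix \<nu> \<mu> assume "\<nu> \<in> ?P" "\<mu> \<in> ?P" "monomial_kernel n Ip \<nu> = monomial_kernel n Ip \<mu>"
    then have gen: "\<nu> \<in> generated_partitions n Ip" "\<mu> \<in> generated_partitions n Ip"
      and eq: "label n -` Ip - \<nu> = label n -` Ip - \<mu>"
      by (simp_all add: monomial_kernel_eq_supported supported_inject)
    have part: "\<nu> \<in> partitions" "\<mu> \<in> partitions"
      using gen by (simp_all add: generated_partitions_def)
    have up: "- \<nu> = up_closure (label n -` Ip - \<nu>)"
      if "\<nu> \<in> generated_partitions n Ip" "\<nu> \<in> partitions" for \<nu>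
      using generated_partitions_iff[OF that(2), of n Ip] that partition_mem_add[OF that(2)]
      unfolding up_closure_def by blast
    have "- \<nu> = - \<mu>"
      unfolding up[OF gen(1) part(1)] up[OF gen(2) part(2)] eq ..
    then show "\<nu> = \<mu>" by simp
  qed
next
  fix K assume "K \<in> monomial_kernel n Ip ` {\<nu> \<in> generated_partitions n Ip. \<forall>i\<in>Ip. wt n i \<nu> = v i}"
  then show "K \<in> fixed_points (Quot n Ip v id)"
    unfolding fixed_points_def generated_partitions_def monomial_kernel_eq_supported
    using monomial_kernel_mem_Quot[OF is_ring_hom_id Ip(2)] torus_act_supported by blast
next
  fix K assume K: "K \<in> fixed_points (Quot n Ip v id)"
  then have "K \<in> Quot n Ip v id" by (simp add: fixed_points_def)
  then have sub: "plane.subspace K" and Kp: "K \<subseteq> supported (label n -` Ip)"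
    and moves: "stable_under_moves n Ip K"
    and basis: "\<And>i. i \<in> Ip \<Longrightarrow> \<exists>F. is_cover F \<and>
      (\<forall>f\<in>F. \<exists>b. local_basis f (supported (label n -` {i})) K {..<v i} b)"
    by (simp_all add: Quot_iff[OF is_ring_hom_id Ip(2)])
  define S where "S = {m. mon m \<in> K}"
  have K_eq: "K = supported S"
    unfolding S_def using K by (intro torus_fixed_eq_supported sub) (simp add: fixed_points_def)
  have S: "S \<subseteq> label n -` Ip" using Kp by (auto simp: S_def)
  have closed: "d + m \<in> S" if "m \<in> S" "label n (d + m) \<in> Ip" for d m
  proof -
    have "mon d * restr (label n -` {label n m}) (mon m) \<in> K"
      using moves that S unfolding stable_under_moves_def S_def by blast
    then show ?thesis by (simp add: restr_mon mon_times_mon S_def)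
  qed
  have cells: "finite (label n -` {i} - S) \<and> card (label n -` {i} - S) = v i" if i: "i \<in> Ip" for i
  proof -
    obtain F where "is_cover F" and b: "\<And>f. f \<in> F \<Longrightarrow> \<exists>b. local_basis f (supported (label n -` {i})) K {..<v i} b"
      using basis[OF i] by blast
    then obtain f b where "f \<noteq> 0" "local_basis f (supported (label n -` {i})) K {..<v i} b"
      using is_cover_nonzero by blast
    moreover have "supported (label n -` {i} - - S) \<subseteq> K"
      unfolding K_eq by (rule supported_mono) auto
    ultimately show ?thesis
      using monomial_basis_card[of "label n -` {i}" "- S" K f "{..<v i}" b] sub K_eq
      by (simp add: Diff_eq)
  qed
  define \<nu> where "\<nu> = - up_closure S"
  have mem: "m \<in> \<nu> \<longleftrightarrow> m \<notin> S" if "label n m \<in> Ip" for m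
    using up_closure_inter_labels[OF S closed that] by (simp add: \<nu>_def)
  obtain i where "i \<in> Ip" using Ip(1) by blast
  then have "\<nu> \<in> generated_partitions n Ip"
    unfolding \<nu>_def using cells by (intro compl_up_closure_generated[OF Ip(2) _ S closed]) auto
  moreover have "wt n i \<nu> = v i" if "i \<in> Ip" for i
  proof -
    have "{c \<in> \<nu>. label n c = i} = label n -` {i} - S" using mem that by auto
    then show ?thesis using cells[OF that] by (simp add: wt_def)
  qed
  moreover have "label n -` Ip - \<nu> = S" using mem S by auto
  ultimately show "K \<in> monomial_kernel n Ip ` {\<nu> \<in> generated_partitions n Ip. \<forall>i\<in>Ip. wt n i \<nu> = v i}"
    by (intro image_eqI[of _ _ \<nu>]) (simp_all add: monomial_kernel_eq_supported K_eq)
qed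

text \<open>
  Both sides are spanned by the monomials outside \<open>\<nu>\<close> with labels in \<open>I\<^sup>+\<close>, because \<open>\<nu>\<close> and
  \<open>pi_gen n Ip \<nu>\<close> contain the same cells with these labels.
\<close>

lemma hilb_to_quot_monomial_ideal:
  assumes Ip: "Ip \<noteq> {}" "Ip \<subseteq> {0..n}" and \<nu>: "\<nu> \<in> partitions"
  shows "hilb_to_quot n Ip id (monomial_ideal \<nu>) = monomial_kernel n Ip (pi_gen n Ip \<nu>)"
proof -
  have "- \<nu> \<inter> label n -` Ip = label n -` Ip - pi_gen n Ip \<nu>"
    using mem_pi_gen_iff[OF Ip \<nu>] by auto
  then show ?thesis
    by (simp add: monomial_ideal_eq_supported monomial_kernel_eq_supported supported_Int
        hilb_to_quot_eq[OF is_ring_hom_id homogeneous_supported Ip(2)])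
qed

lemma wt_pi_gen:
  assumes "Ip \<noteq> {}" "Ip \<subseteq> {0..n}" "\<nu> \<in> partitions" "i \<in> Ip"
  shows "wt n i (pi_gen n Ip \<nu>) = wt n i \<nu>"
proof -
  have "{c \<in> pi_gen n Ip \<nu>. label n c = i} = {c \<in> \<nu>. label n c = i}"
    using mem_pi_gen_iff[OF assms(1-3)] assms(4) by auto
  then show ?thesis by (simp add: wt_def)
qed

theorem proposition4p7:
  fixes n :: nat and Ip :: "nat set" and v :: "nat \<Rightarrow> nat"
    and alg :: "complex \<Rightarrow> 'a::comm_ring_1" and h :: "'a \<Rightarrow> 'b::comm_ring_1"
  assumes "n \<ge> 1" and "Ip \<noteq> {}" and "Ip \<subset> {0..n}"
    and "is_ring_hom alg" and "is_ring_hom h"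
  shows
    "(\<forall>J\<in>Hilb n v alg. hilb_to_quot n Ip alg J \<in> Quot n Ip v alg) \<and>
     (\<forall>J\<in>Hilb n v alg.
         hilb_to_quot n Ip (h \<circ> alg) (base_change h J) = base_change h (hilb_to_quot n Ip alg J)) \<and>
     (\<forall>t\<in>torus. \<forall>J\<in>Hilb n v alg. torus_act t ` J \<in> Hilb n v alg) \<and>
     (\<forall>t\<in>torus. \<forall>K\<in>Quot n Ip v alg. torus_act t ` K \<in> Quot n Ip v alg) \<and>
     (\<forall>t\<in>torus. \<forall>J\<in>Hilb n v alg.
         hilb_to_quot n Ip alg (torus_act t ` J) = torus_act t ` hilb_to_quot n Ip alg J) \<and>
     (\<forall>J\<in>fixed_points (Hilb n v id). hilb_to_quot n Ip id J \<in> fixed_points (Quot n Ip v id)) \<and>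
     (bij_betw monomial_ideal
         {\<nu> \<in> partitions. \<forall>i\<in>{0..n}. wt n i \<nu> = v i}
         (fixed_points (Hilb n v id))) \<and>
     (bij_betw (monomial_kernel n Ip)
         {\<nu> \<in> generated_partitions n Ip. \<forall>i\<in>Ip. wt n i \<nu> = v i}
         (fixed_points (Quot n Ip v id))) \<and>
     (\<forall>\<nu>\<in>{\<nu> \<in> partitions. \<forall>i\<in>{0..n}. wt n i \<nu> = v i}.
         pi_gen n Ip \<nu> \<in> {\<mu> \<in> generated_partitions n Ip. \<forall>i\<in>Ip. wt n i \<mu> = v i} \<and>
         hilb_to_quot n Ip id (monomial_ideal \<nu>) = monomial_kernel n Ip (pi_gen n Ip \<nu>))"
proof (intro conjI ballI)
  have Ip: "Ip \<subseteq> {0..n}" using assms(3) by blast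
  note alg = assms(4) and h = assms(5)
  show "hilb_to_quot n Ip alg J \<in> Quot n Ip v alg" if "J \<in> Hilb n v alg" for J
    by (rule hilb_to_quot_mem_Quot[OF alg Ip that])
  show "hilb_to_quot n Ip (h \<circ> alg) (base_change h J) = base_change h (hilb_to_quot n Ip alg J)"
    if "J \<in> Hilb n v alg" for J
    by (rule hilb_to_quot_base_change[OF alg h Ip Hilb_homogeneous[OF alg that]])
  show "torus_act t ` J \<in> Hilb n v alg" if "t \<in> torus" "J \<in> Hilb n v alg" for t J
    by (rule torus_act_Hilb[OF alg that])
  show "torus_act t ` K \<in> Quot n Ip v alg" if "t \<in> torus" "K \<in> Quot n Ip v alg" for t K
    by (rule torus_act_Quot[OF alg Ip that])
  show "hilb_to_quot n Ip alg (torus_act t ` J) = torus_act t ` hilb_to_quot n Ip alg J"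
    if "t \<in> torus" "J \<in> Hilb n v alg" for t J
    by (rule hilb_to_quot_torus_act[OF alg Ip that])
  show "hilb_to_quot n Ip id J \<in> fixed_points (Quot n Ip v id)"
    if "J \<in> fixed_points (Hilb n v id)" for J
    by (rule hilb_to_quot_fixed_points[OF Ip that])
  show "bij_betw monomial_ideal {\<nu> \<in> partitions. \<forall>i\<in>{0..n}. wt n i \<nu> = v i}
      (fixed_points (Hilb n v id))"
    by (rule bij_betw_monomial_ideal)
  show "bij_betw (monomial_kernel n Ip)
      {\<nu> \<in> generated_partitions n Ip. \<forall>i\<in>Ip. wt n i \<nu> = v i} (fixed_points (Quot n Ip v id))"
    by (rule bij_betw_monomial_kernel[OF assms(2) Ip])
  fix \<nu> assume "\<nu> \<in> {\<nu> \<in> partitions. \<forall>i\<in>{0..n}. wt n i \<nu> = v i}"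
  then have \<nu>: "\<nu> \<in> partitions" and wt: "\<forall>i\<in>{0..n}. wt n i \<nu> = v i" by simp_all
  show "pi_gen n Ip \<nu> \<in> {\<mu> \<in> generated_partitions n Ip. \<forall>i\<in>Ip. wt n i \<mu> = v i}"
    using pi_gen_generated[OF assms(2) Ip \<nu>] wt_pi_gen[OF assms(2) Ip \<nu>] wt Ip by auto
  show "hilb_to_quot n Ip id (monomial_ideal \<nu>) = monomial_kernel n Ip (pi_gen n Ip \<nu>)"
    by (rule hilb_to_quot_monomial_ideal[OF assms(2) Ip \<nu>])
qed

end
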